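(* For every non-constant monotone graph property $P$ on $n$-vertex directed graphs, $Q_E(P)\in\Omega(n^2)$. Moreover, there is a non-constant monotone graph property $P$ such that $Q_E(P)<n(n-1)$ for every $n>2$.
   Context: An $n$-vertex directed graph is represented by $N=n(n-1)$ bits, one per possible edge $(i,j)$, $i\ne j$, indicating whether the edge is present. A graph property is a function $P:\{0,1\}^{n(n-1)}\to\{0,1\}$ invariant under permutations of the vertices; it is monotone if adding edges cannot change the value from 1 to 0, and non-constant if it takes both values. In the quantum query model the input bits are accessed only via the gate $|j,b\rangle\mapsto|j,b\oplus x_j\rangle$ interleaved with input-independent unitaries; $Q_E(P)$ is the minimal worst-case number of queries of a quantum algorithm that outputs $P(x)$ with certainty on every input. *)

theory Defs
  imports
    Complex_Main
    "HOL-Library.FuncSet"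
    "HOL-Library.Extended_Nat"
    "HOL-Library.Extended_Real"
    "HOL-Combinatorics.Permutations"
begin

section \<open>Boolean inputs and directed graph properties\<close>

text \<open>The set of bit strings indexed by \<open>J\<close>. Its elements are extensional functions, so each
  bit string is represented exactly once, and the pointwise order of functions compares the bits
  in \<open>J\<close> only.\<close>

definition inputs :: "'j set \<Rightarrow> ('j \<Rightarrow> bool) set" where
  "inputs J = J \<rightarrow>\<^sub>E UNIV"

definition edges :: "nat \<Rightarrow> (nat \<times> nat) set" where
  "edges n = {(i, j). i < n \<and> j < n \<and> i \<noteq> j}"

lemma finite_edges [simp]: "finite (edges n)"
  by (rule finite_subset[of _ "{..<n} \<times> {..<n}"]) (auto simp: edges_def)

lemma card_edges: "card (edges n) = n * (n - 1)"
proof -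
  have "edges n = (SIGMA i:{..<n}. {..<n} - {i})"
    by (auto simp: edges_def)
  then show ?thesis
    by simp
qed

definition relabel :: "nat \<Rightarrow> (nat \<Rightarrow> nat) \<Rightarrow> (nat \<times> nat \<Rightarrow> bool) \<Rightarrow> (nat \<times> nat \<Rightarrow> bool)" where
  "relabel n \<pi> x = restrict (\<lambda>(i, j). x (\<pi> i, \<pi> j)) (edges n)"

definition graph_property :: "nat \<Rightarrow> ((nat \<times> nat \<Rightarrow> bool) \<Rightarrow> bool) \<Rightarrow> bool" where
  "graph_property n P \<longleftrightarrow>
     (\<forall>\<pi>. \<pi> permutes {..<n} \<longrightarrow> (\<forall>x\<in>inputs (edges n). P (relabel n \<pi> x) = P x))"

definition nonconst_monotone_graph_property ::
  "nat \<Rightarrow> ((nat \<times> nat \<Rightarrow> bool) \<Rightarrow> bool) \<Rightarrow> bool" where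
  "nonconst_monotone_graph_property n P \<longleftrightarrow>
     graph_property n P \<and>
     mono_on (inputs (edges n)) P \<and>
     P ` inputs (edges n) = {False, True}"


section \<open>Exact quantum query algorithms\<close>

text \<open>The state space has the orthonormal basis \<open>|j, b, z\<rangle>\<close> with an index \<open>j \<in> J\<close>, a target bit
  \<open>b\<close>, and a workspace value \<open>z\<close> ranging over \<open>m\<close> values. States and operators are given by
  their coordinates \<open>\<langle>a|\<psi>\<rangle>\<close> and \<open>\<langle>a|U|c\<rangle>\<close> for basis elements \<open>a\<close> and \<open>c\<close>;
  coordinates outside the basis are never inspected.\<close>

type_synonym 'j ket = "'j \<times> bool \<times> nat"
type_synonym 'j state = "'j ket \<Rightarrow> complex"
type_synonym 'j oper = "'j ket \<Rightarrow> 'j ket \<Rightarrow> complex"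

definition basis :: "'j set \<Rightarrow> nat \<Rightarrow> 'j ket set" where
  "basis J m = J \<times> UNIV \<times> {..<m}"

definition apply_oper :: "'j ket set \<Rightarrow> 'j oper \<Rightarrow> 'j state \<Rightarrow> 'j state" where
  "apply_oper B U \<psi> = (\<lambda>a. \<Sum>c\<in>B. U a c * \<psi> c)"

definition unitary_on :: "'j ket set \<Rightarrow> 'j oper \<Rightarrow> bool" where
  "unitary_on B U \<longleftrightarrow>
     (\<forall>a\<in>B. \<forall>c\<in>B. (\<Sum>d\<in>B. cnj (U d a) * U d c) = (if a = c then 1 else 0)) \<and>
     (\<forall>a\<in>B. \<forall>c\<in>B. (\<Sum>d\<in>B. U a d * cnj (U c d)) = (if a = c then 1 else 0))"

text \<open>The linear extension of \<open>|j, b, z\<rangle> \<mapsto> |j, b \<oplus> x\<^sub>j, z\<rangle>\<close>, where \<open>\<noteq>\<close> on truth values is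
  exclusive or. The gate is an involution, so the new amplitude at a basis element is the old
  amplitude at its image.\<close>

definition query :: "('j \<Rightarrow> bool) \<Rightarrow> 'j state \<Rightarrow> 'j state" where
  "query x \<psi> = (\<lambda>(j, b, z). \<psi> (j, b \<noteq> x j, z))"

text \<open>The state \<open>U\<^sub>T O\<^sub>x U\<^bsub>T-1\<^esub> \<dots> O\<^sub>x U\<^sub>0 |s\<rangle>\<close>.\<close>

primrec run :: "'j ket set \<Rightarrow> (nat \<Rightarrow> 'j oper) \<Rightarrow> 'j ket \<Rightarrow> ('j \<Rightarrow> bool) \<Rightarrow> nat \<Rightarrow> 'j state" where
  "run B U s x 0 = apply_oper B (U 0) (\<lambda>a. if a = s then 1 else 0)"
| "run B U s x (Suc T) = apply_oper B (U (Suc T)) (query x (run B U s x T))"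

text \<open>The probability of output \<open>v\<close> when \<open>\<psi>\<close> is measured in the basis \<open>B\<close> and the output is 1
  exactly if the observed basis element lies in \<open>A\<close>.\<close>

definition output_prob :: "'j ket set \<Rightarrow> 'j ket set \<Rightarrow> 'j state \<Rightarrow> bool \<Rightarrow> real" where
  "output_prob B A \<psi> v = (\<Sum>a\<in>{a \<in> B. (a \<in> A) = v}. (cmod (\<psi> a))\<^sup>2)"

definition exactly_computable :: "'j set \<Rightarrow> (('j \<Rightarrow> bool) \<Rightarrow> bool) \<Rightarrow> nat \<Rightarrow> bool" where
  "exactly_computable J f T \<longleftrightarrow>
     (\<exists>m s U A. s \<in> basis J m \<and>
        (\<forall>t\<le>T. unitary_on (basis J m) (U t)) \<and>
        (\<forall>x\<in>inputs J. output_prob (basis J m) A (run (basis J m) U s x T) (f x) = 1))"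

text \<open>As an infimum of extended naturals, this is the least number of queries if there is an exact
  algorithm, and infinite otherwise.\<close>

definition Q_E :: "'j set \<Rightarrow> (('j \<Rightarrow> bool) \<Rightarrow> bool) \<Rightarrow> enat" where
  "Q_E J f = (INF T\<in>{T. exactly_computable J f T}. enat T)"

end

theory Submission
  imports Defs "HOL-Computational_Algebra.Primes"
begin

text \<open>Lower bound: after \<open>T\<close> queries the acceptance probability is a polynomial of degree at most \<open>2T\<close> in
  the input bits. If some restriction of \<open>P\<close> to \<open>N\<close> free bits (with repetitions and constants) has an odd
  number of accepted inputs, its polynomial has degree \<open>N\<close>, hence \<open>N \<le> 2T\<close>. Following Rivest and
  Vuillemin, the free bits are the edges between two vertex sets of size \<open>2\<^sup>d\<close>, permuted transitively by a
  2-group of symmetries of the fixed edges: only the empty and the full configuration are fixed by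
  the group, and exactly one of them is accepted.

  Upper bound: the property is a threshold on the number of edges. One quantum query yields the exclusive or
  of two bits. Two differing bits cancel against each other, which saves a query; equal bits are
  merged into one bit of double weight. Since \<open>n(n - 1)\<close> is not a power of 2, merging ends with an
  odd number of bits greater than 1, and then the threshold can be chosen such that one bit never matters.\<close>

section \<open>Unitary operators\<close>

text \<open>An odd count suffices because the top coefficient of the polynomial is, up to sign, the
  sum of (-1)^|Y| over the accepted sets Y, an integer with the parity of their number. The obstacle
  is that a transitive 2-group needs a vertex set whose size is a power of 2, while n is arbitrary.
  Excess vertices are removed one by one, fixed as isolated or as adjacent to all others, as long as
  the remaining property is non-constant. If both choices make it constant, that very failure
  supplies a fixed graph to which the free edges can be added, without reducing the vertex set any
  further. More than n^2/16 bits can be freed, and the factor 2 in the degree turns this into the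
  constant 1/32. The threshold for the upper bound comes from n(n - 1) = 2^a b with b odd: it is
  2^(a+1), which a halvings bring down to 2 with b bits left.\<close>

definition inner_on :: "'k set \<Rightarrow> ('k \<Rightarrow> complex) \<Rightarrow> ('k \<Rightarrow> complex) \<Rightarrow> complex" where
  "inner_on B u w = (\<Sum>a\<in>B. cnj (u a) * w a)"

definition orthonormal_family :: "'k set \<Rightarrow> 'i set \<Rightarrow> ('i \<Rightarrow> 'k \<Rightarrow> complex) \<Rightarrow> bool" where
  "orthonormal_family B I u \<longleftrightarrow>
     (\<forall>k\<in>I. \<forall>l\<in>I. inner_on B (u k) (u l) = (if k = l then 1 else 0))"

lemma inner_on_cong:
  "(\<And>a. a \<in> B \<Longrightarrow> u a = u' a) \<Longrightarrow> (\<And>a. a \<in> B \<Longrightarrow> w a = w' a) \<Longrightarrow> inner_on B u w = inner_on B u' w'"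
  by (simp add: inner_on_def)

lemma cnj_inner_on: "cnj (inner_on B u w) = inner_on B w u"
  by (simp add: inner_on_def mult.commute)

lemma inner_on_diff_left: "inner_on B (\<lambda>a. u a - v a) w = inner_on B u w - inner_on B v w"
  by (simp add: inner_on_def left_diff_distrib sum_subtractf)

lemma inner_on_diff_right: "inner_on B w (\<lambda>a. u a - v a) = inner_on B w u - inner_on B w v"
  by (simp add: inner_on_def right_diff_distrib sum_subtractf)

lemma apply_oper_cong:
  "(\<And>a. a \<in> B \<Longrightarrow> \<psi> a = \<psi>' a) \<Longrightarrow> apply_oper B U \<psi> = apply_oper B U \<psi>'"
  by (simp add: apply_oper_def)

lemma apply_oper_scale: "apply_oper B U (\<lambda>a. c * \<psi> a) = (\<lambda>a. c * apply_oper B U \<psi> a)"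
  by (simp add: apply_oper_def sum_distrib_left mult_ac)

lemma inner_on_apply_oper:
  assumes "finite B" "unitary_on B U"
  shows "inner_on B (apply_oper B U u) (apply_oper B U w) = inner_on B u w"
proof -
  have "inner_on B (apply_oper B U u) (apply_oper B U w)
      = (\<Sum>d\<in>B. (\<Sum>a\<in>B. cnj (U d a) * cnj (u a)) * (\<Sum>c\<in>B. U d c * w c))"
    by (simp add: inner_on_def apply_oper_def)
  also have "\<dots> = (\<Sum>d\<in>B. \<Sum>c\<in>B. \<Sum>a\<in>B. (cnj (U d a) * U d c) * (cnj (u a) * w c))"
    unfolding sum_product by (subst sum.swap) (simp add: mult_ac)
  also have "\<dots> = (\<Sum>c\<in>B. \<Sum>a\<in>B. (\<Sum>d\<in>B. cnj (U d a) * U d c) * (cnj (u a) * w c))"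
    unfolding sum_distrib_right
    by (subst sum.swap) (intro sum.cong refl sum.swap)
  also have "\<dots> = (\<Sum>c\<in>B. \<Sum>a\<in>B. (if a = c then cnj (u a) * w c else 0))"
    using assms(2) unfolding unitary_on_def by (intro sum.cong refl) auto
  also have "\<dots> = inner_on B u w"
    using assms(1) by (simp add: sum.delta inner_on_def)
  finally show ?thesis .
qed

lemma apply_oper_norm:
  assumes "finite B" "unitary_on B U"
  shows "(\<Sum>a\<in>B. (cmod (apply_oper B U \<psi> a))\<^sup>2) = (\<Sum>a\<in>B. (cmod (\<psi> a))\<^sup>2)"
proof -
  have *: "complex_of_real (\<Sum>a\<in>B. (cmod (\<phi> a))\<^sup>2) = inner_on B \<phi> \<phi>" for \<phi> :: "'a state"
    unfolding of_real_sum complex_norm_square inner_on_def by (simp only: mult.commute)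
  show ?thesis
    using inner_on_apply_oper[OF assms, of \<psi> \<psi>] unfolding *[symmetric] of_real_eq_iff .
qed

section \<open>Products, adjoints and rank-one updates of unitary operators\<close>

definition oper_mult :: "'j ket set \<Rightarrow> 'j oper \<Rightarrow> 'j oper \<Rightarrow> 'j oper" where
  "oper_mult B U V = (\<lambda>a c. \<Sum>d\<in>B. U a d * V d c)"

lemma apply_oper_mult: "apply_oper B (oper_mult B U V) \<psi> = apply_oper B U (apply_oper B V \<psi>)"
proof
  fix a
  have "apply_oper B (oper_mult B U V) \<psi> a = (\<Sum>c\<in>B. \<Sum>d\<in>B. U a d * (V d c * \<psi> c))"
    by (simp add: apply_oper_def oper_mult_def sum_distrib_right mult.assoc)
  also have "\<dots> = (\<Sum>d\<in>B. \<Sum>c\<in>B. U a d * (V d c * \<psi> c))" by (rule sum.swap)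
  finally show "apply_oper B (oper_mult B U V) \<psi> a = apply_oper B U (apply_oper B V \<psi>) a"
    by (simp add: apply_oper_def sum_distrib_left)
qed

text \<open>One half of \<open>unitary_on\<close>; the other half is the same condition for the
  adjoint. The adjoint of a product or of a rank-one update has the same form, so each calculation
  is done only once.\<close>

definition isometry_on :: "'j ket set \<Rightarrow> 'j oper \<Rightarrow> bool" where
  "isometry_on B U \<longleftrightarrow> (\<forall>a\<in>B. \<forall>c\<in>B. inner_on B (\<lambda>d. U d a) (\<lambda>d. U d c) = (if a = c then 1 else 0))"

definition adjoint_oper :: "'j oper \<Rightarrow> 'j oper" where
  "adjoint_oper U = (\<lambda>a c. cnj (U c a))"

lemma unitary_on_iff: "unitary_on B U \<longleftrightarrow> isometry_on B U \<and> isometry_on B (adjoint_oper U)"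
  unfolding unitary_on_def isometry_on_def adjoint_oper_def inner_on_def by simp

lemma isometry_on_mult:
  assumes "finite B" "unitary_on B U" "isometry_on B V"
  shows "isometry_on B (oper_mult B U V)"
  unfolding isometry_on_def
proof (intro ballI)
  fix a c assume "a \<in> B" "c \<in> B"
  have "(\<lambda>d. oper_mult B U V d e) = apply_oper B U (\<lambda>d. V d e)" for e
    by (simp add: oper_mult_def apply_oper_def)
  then show "inner_on B (\<lambda>d. oper_mult B U V d a) (\<lambda>d. oper_mult B U V d c) = (if a = c then 1 else 0)"
    using inner_on_apply_oper[OF assms(1,2)] assms(3) \<open>a \<in> B\<close> \<open>c \<in> B\<close>
    by (simp add: isometry_on_def)
qed

lemma unitary_on_adjoint: "unitary_on B U \<Longrightarrow> unitary_on B (adjoint_oper U)"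
proof -
  have "adjoint_oper (adjoint_oper U) = U" by (simp add: adjoint_oper_def)
  then show "unitary_on B U \<Longrightarrow> unitary_on B (adjoint_oper U)" by (simp add: unitary_on_iff)
qed

lemma unitary_on_mult:
  assumes "finite B" "unitary_on B U" "unitary_on B V"
  shows "unitary_on B (oper_mult B U V)"
proof -
  have "adjoint_oper (oper_mult B U V) = oper_mult B (adjoint_oper V) (adjoint_oper U)"
    by (simp add: adjoint_oper_def oper_mult_def mult.commute)
  then show ?thesis
    using assms unitary_on_adjoint unfolding unitary_on_iff[of B "oper_mult B U V"]
    by (metis isometry_on_mult unitary_on_iff)
qed

definition id_oper :: "'j oper" where
  "id_oper = (\<lambda>a c. if a = c then 1 else 0)"

lemma apply_id_oper: "finite B \<Longrightarrow> a \<in> B \<Longrightarrow> apply_oper B id_oper \<psi> a = \<psi> a"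
  by (simp add: apply_oper_def id_oper_def if_distrib[where f = "\<lambda>x. x * _"] cong: if_cong)

lemma unitary_on_id: "finite B \<Longrightarrow> unitary_on B id_oper"
  unfolding unitary_on_def id_oper_def
  by (auto simp: if_distrib[where f = cnj] if_distrib[where f = "\<lambda>x. x * _"] cong: if_cong)

text \<open>The operator I - \<kappa> |v><v|. A complex \<kappa> is allowed because the ordinary
  reflection along u - w, with real factor 2 / <v, v>, maps a unit vector u to a unit vector w only
  if <w, u> is real.\<close>

definition rank_one_update :: "complex \<Rightarrow> ('j ket \<Rightarrow> complex) \<Rightarrow> 'j oper" where
  "rank_one_update \<kappa> v = (\<lambda>a c. id_oper a c - \<kappa> * v a * cnj (v c))"

lemma apply_rank_one_update:
  assumes "finite B" "a \<in> B"
  shows "apply_oper B (rank_one_update \<kappa> v) \<psi> a = \<psi> a - \<kappa> * inner_on B v \<psi> * v a"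
proof -
  have "apply_oper B (rank_one_update \<kappa> v) \<psi> a
      = apply_oper B id_oper \<psi> a - (\<Sum>c\<in>B. \<kappa> * v a * (cnj (v c) * \<psi> c))"
    by (simp add: apply_oper_def rank_one_update_def left_diff_distrib sum_subtractf mult.assoc)
  then show ?thesis
    using assms by (simp add: apply_id_oper inner_on_def sum_distrib_left mult_ac)
qed

text \<open>The adjoint times the operator is the identity plus a multiple of |v><v|; the assumption
  says that its coefficient |\<kappa>|^2 <v, v> - (\<kappa> + cnj \<kappa>) is 0.\<close>

lemma isometry_on_rank_one_update:
  assumes "finite B" "\<kappa> + cnj \<kappa> = \<kappa> * cnj \<kappa> * inner_on B v v"
  shows "isometry_on B (rank_one_update \<kappa> v)"
  unfolding isometry_on_def
proof (intro ballI)
  fix a c assume "a \<in> B" "c \<in> B"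
  have "inner_on B (\<lambda>d. rank_one_update \<kappa> v d a) (\<lambda>d. rank_one_update \<kappa> v d c)
      = (\<Sum>d\<in>B. cnj (id_oper d a) * id_oper d c) - (\<Sum>d\<in>B. id_oper d a * v d) * (\<kappa> * cnj (v c))
        - (\<Sum>d\<in>B. id_oper d c * cnj (v d)) * (cnj \<kappa> * v a)
        + (\<Sum>d\<in>B. cnj (v d) * v d) * (\<kappa> * cnj \<kappa> * v a * cnj (v c))"
    unfolding inner_on_def rank_one_update_def sum_distrib_right sum_subtractf[symmetric] sum.distrib[symmetric]
    by (intro sum.cong refl) (simp add: id_oper_def algebra_simps)
  also have "(\<Sum>d\<in>B. cnj (id_oper d a) * id_oper d c) = (if a = c then 1 else 0)"
    using unitary_on_id[OF assms(1)] \<open>a \<in> B\<close> \<open>c \<in> B\<close> by (simp add: unitary_on_def)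
  also have "(\<Sum>d\<in>B. id_oper d a * v d) = v a"
    using \<open>a \<in> B\<close> assms(1)
    by (simp add: id_oper_def if_distrib[where f = "\<lambda>x. x * _"] cong: if_cong)
  also have "(\<Sum>d\<in>B. id_oper d c * cnj (v d)) = cnj (v c)"
    using \<open>c \<in> B\<close> assms(1)
    by (simp add: id_oper_def if_distrib[where f = "\<lambda>x. x * _"] cong: if_cong)
  also have "(if a = c then 1 else 0) - v a * (\<kappa> * cnj (v c)) - cnj (v c) * (cnj \<kappa> * v a)
        + (\<Sum>d\<in>B. cnj (v d) * v d) * (\<kappa> * cnj \<kappa> * v a * cnj (v c))
      = (if a = c then 1 else 0) + (\<kappa> * cnj \<kappa> * inner_on B v v - (\<kappa> + cnj \<kappa>)) * (v a * cnj (v c))"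
    by (simp add: inner_on_def algebra_simps)
  also have "\<dots> = (if a = c then 1 else 0)"
    by (simp add: assms(2))
  finally show "inner_on B (\<lambda>d. rank_one_update \<kappa> v d a) (\<lambda>d. rank_one_update \<kappa> v d c)
      = (if a = c then 1 else 0)" .
qed

lemma unitary_on_rank_one_update:
  assumes "finite B" "\<kappa> + cnj \<kappa> = \<kappa> * cnj \<kappa> * inner_on B v v"
  shows "unitary_on B (rank_one_update \<kappa> v)"
proof -
  have "adjoint_oper (rank_one_update \<kappa> v) = rank_one_update (cnj \<kappa>) v"
    by (auto simp: adjoint_oper_def rank_one_update_def id_oper_def mult_ac intro!: ext)
  then show ?thesis
    using isometry_on_rank_one_update[of B \<kappa> v] isometry_on_rank_one_update[of B "cnj \<kappa>" v] assms
    by (simp add: unitary_on_iff add.commute mult.commute)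
qed

lemma inner_on_self_eq_0: "finite B \<Longrightarrow> inner_on B v v = 0 \<Longrightarrow> a \<in> B \<Longrightarrow> v a = 0"
proof -
  assume "finite B" "inner_on B v v = 0" "a \<in> B"
  have "inner_on B v v = complex_of_real (\<Sum>a\<in>B. (cmod (v a))\<^sup>2)"
    unfolding of_real_sum complex_norm_square inner_on_def by (simp only: mult.commute)
  then have "(\<Sum>a\<in>B. (cmod (v a))\<^sup>2) = 0"
    using \<open>inner_on B v v = 0\<close> by (metis of_real_eq_0_iff)
  then show "v a = 0" using \<open>finite B\<close> \<open>a \<in> B\<close> by (simp add: sum_nonneg_eq_0_iff)
qed

text \<open>A complex Householder reflection: with \<open>v = u - w\<close> and \<open>\<kappa> = 1 / (1 - \<langle>w, u\<rangle>)\<close> one has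
  \<open>\<kappa> \<langle>v, u\<rangle> = 1\<close>.\<close>

lemma ex_unitary_moving:
  assumes "finite B" "inner_on B u u = 1" "inner_on B w w = 1"
  shows "\<exists>H. unitary_on B H \<and> (\<forall>a\<in>B. apply_oper B H u a = w a) \<and>
    (\<forall>\<psi>. inner_on B u \<psi> = 0 \<longrightarrow> inner_on B w \<psi> = 0 \<longrightarrow> (\<forall>a\<in>B. apply_oper B H \<psi> a = \<psi> a))"
proof (cases "\<forall>a\<in>B. u a = w a")
  case True
  then show ?thesis
    using assms by (intro exI[of _ id_oper]) (auto simp: unitary_on_id apply_id_oper)
next
  case False
  define v where "v = (\<lambda>a. u a - w a)"
  define s where "s = 1 - inner_on B w u"
  have vv: "inner_on B v v = s + cnj s" and vu: "inner_on B v u = s"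
    using assms by (simp_all add: v_def s_def inner_on_diff_left inner_on_diff_right cnj_inner_on)
  have "s \<noteq> 0"
  proof
    assume "s = 0"
    then have "v a = 0" if "a \<in> B" for a
      using inner_on_self_eq_0[of B v] assms(1) vv that by simp
    then show False using False by (simp add: v_def)
  qed
  have "1 / s + cnj (1 / s) = 1 / s * cnj (1 / s) * inner_on B v v"
    using \<open>s \<noteq> 0\<close> unfolding vv by (simp add: field_simps)
  then have "unitary_on B (rank_one_update (1 / s) v)"
    by (rule unitary_on_rank_one_update[OF assms(1)])
  moreover have "apply_oper B (rank_one_update (1 / s) v) u a = w a" if "a \<in> B" for a
    using that assms(1) \<open>s \<noteq> 0\<close> by (simp add: apply_rank_one_update vu) (simp add: v_def)
  moreover have "apply_oper B (rank_one_update (1 / s) v) \<psi> a = \<psi> a"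
    if "inner_on B u \<psi> = 0" "inner_on B w \<psi> = 0" "a \<in> B" for \<psi> a
    using that assms(1) by (simp add: apply_rank_one_update v_def inner_on_diff_left)
  ultimately show ?thesis by blast
qed

text \<open>This lets an algorithm be specified only on the states that it reaches. The unitary
  found for \<open>I\<close> is followed by one that moves the image of \<open>u k\<close> to
  \<open>w k\<close>; every earlier \<open>w l\<close> is orthogonal to both vectors and hence stays
  fixed.\<close>

lemma ex_unitary_orthonormal_families:
  assumes "finite B" "finite I" "orthonormal_family B I u" "orthonormal_family B I w"
  shows "\<exists>U. unitary_on B U \<and> (\<forall>k\<in>I. \<forall>a\<in>B. apply_oper B U (u k) a = w k a)"
  using assms(2-)
proof (induction I rule: finite_induct)
  case empty
  show ?case using unitary_on_id[OF assms(1)] by auto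
next
  case (insert k I)
  then obtain U where U: "unitary_on B U" "\<And>l a. l \<in> I \<Longrightarrow> a \<in> B \<Longrightarrow> apply_oper B U (u l) a = w l a"
    by (auto simp: orthonormal_family_def)
  let ?u = "apply_oper B U (u k)"
  have u: "inner_on B ?u ?u = 1"
    using insert.prems(1) by (simp add: inner_on_apply_oper[OF assms(1) U(1)] orthonormal_family_def)
  have w: "inner_on B (w k) (w k) = 1"
    using insert.prems(2) by (simp add: orthonormal_family_def)
  obtain H where H: "unitary_on B H" "\<And>a. a \<in> B \<Longrightarrow> apply_oper B H ?u a = w k a"
    "\<And>\<psi> a. inner_on B ?u \<psi> = 0 \<Longrightarrow> inner_on B (w k) \<psi> = 0 \<Longrightarrow> a \<in> B \<Longrightarrow> apply_oper B H \<psi> a = \<psi> a"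
    using ex_unitary_moving[OF assms(1) u w] by blast
  have "apply_oper B (oper_mult B H U) (u l) a = w l a" if "l \<in> insert k I" "a \<in> B" for l a
  proof (cases "l = k")
    case True
    then show ?thesis using H(2) that by (simp add: apply_oper_mult)
  next
    case False
    then have l: "l \<in> I" using that by simp
    have "inner_on B ?u (w l) = inner_on B ?u (apply_oper B U (u l))"
      using U(2)[OF l] by (intro inner_on_cong) auto
    also have "\<dots> = 0"
      using insert.prems(1) insert.hyps(2) l
      by (auto simp: inner_on_apply_oper[OF assms(1) U(1)] orthonormal_family_def)
    finally have "inner_on B ?u (w l) = 0" .
    moreover have "inner_on B (w k) (w l) = 0"
      using insert.prems(2) insert.hyps(2) l by (auto simp: orthonormal_family_def)
    moreover have "apply_oper B H (apply_oper B U (u l)) = apply_oper B H (w l)"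
      by (rule apply_oper_cong) (rule U(2)[OF l])
    ultimately show ?thesis using H(3) that(2) by (simp add: apply_oper_mult)
  qed
  then show ?case using unitary_on_mult[OF assms(1) H(1) U(1)] by blast
qed

section \<open>Norm preservation of runs, and what exactness says about acceptance\<close>

lemma query_norm:
  "(\<Sum>a\<in>basis J m. (cmod (query x \<psi> a))\<^sup>2) = (\<Sum>a\<in>basis J m. (cmod (\<psi> a))\<^sup>2)"
  by (rule sum.reindex_bij_witness[of _ "\<lambda>(j, b, z). (j, b \<noteq> x j, z)" "\<lambda>(j, b, z). (j, b \<noteq> x j, z)"])
    (auto simp: basis_def query_def)

lemma finite_basis [simp]: "finite J \<Longrightarrow> finite (basis J m)"
  by (simp add: basis_def)

lemma run_norm:
  assumes "finite J" "s \<in> basis J m" "\<And>t. t \<le> T \<Longrightarrow> unitary_on (basis J m) (U t)"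
  shows "(\<Sum>a\<in>basis J m. (cmod (run (basis J m) U s x T a))\<^sup>2) = 1"
  using assms(3)
proof (induction T)
  case 0
  then have "(\<Sum>a\<in>basis J m. (cmod (run (basis J m) U s x 0 a))\<^sup>2)
      = (\<Sum>a\<in>basis J m. (cmod (if a = s then 1 else 0))\<^sup>2)"
    using assms(1) by (simp add: apply_oper_norm)
  also have "\<dots> = (\<Sum>a\<in>basis J m. if a = s then 1 else 0)"
    by (intro sum.cong) auto
  finally show ?case
    using assms(1,2) by simp
next
  case (Suc T)
  then show ?case
    using assms(1) by (simp add: apply_oper_norm query_norm)
qed

text \<open>The total probability is 1, so certainty of the correct output leaves 0 for the wrong
  one. The acceptance probability therefore equals the function value at rejected inputs
  too.\<close>

lemma output_prob_True:
  assumes "finite B" "(\<Sum>a\<in>B. (cmod (\<psi> a))\<^sup>2) = 1" "output_prob B A \<psi> v = 1"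
  shows "output_prob B A \<psi> True = of_bool v"
proof -
  have "(\<Sum>a\<in>B. (cmod (\<psi> a))\<^sup>2) = output_prob B A \<psi> True + output_prob B A \<psi> False"
    unfolding output_prob_def
    by (subst sum.union_disjoint[symmetric]) (auto intro!: sum.cong simp: assms(1))
  then show ?thesis using assms by (cases v) auto
qed

section \<open>The polynomial method\<close>

text \<open>Polynomials of degree at most \<open>d\<close> in 0/1 variables, one for each possible
  element of \<open>Y\<close>; \<open>mem\<close> multiplies by the variable of \<open>y\<close>.
  Variables are idempotent, so every such polynomial is multilinear as a function of
  \<open>Y\<close>.\<close>

inductive lowdeg :: "nat \<Rightarrow> ('a set \<Rightarrow> complex) \<Rightarrow> bool" where
  const: "lowdeg d (\<lambda>_. c)"
| add: "lowdeg d p \<Longrightarrow> lowdeg d q \<Longrightarrow> lowdeg d (\<lambda>Y. p Y + q Y)"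
| mem: "lowdeg d p \<Longrightarrow> lowdeg (Suc d) (\<lambda>Y. if y \<in> Y then p Y else 0)"

lemma lowdeg_Suc: "lowdeg d p \<Longrightarrow> lowdeg (Suc d) p"
  by (induction rule: lowdeg.induct) (auto intro: lowdeg.intros)

lemma lowdeg_mono: "lowdeg d p \<Longrightarrow> d \<le> e \<Longrightarrow> lowdeg e p"
  by (induction e) (auto simp: le_Suc_eq intro: lowdeg_Suc)

lemma lowdeg_mult: "lowdeg d p \<Longrightarrow> lowdeg e q \<Longrightarrow> lowdeg (d + e) (\<lambda>Y. p Y * q Y)"
proof (induction rule: lowdeg.induct)
  case (const d c)
  have "lowdeg e (\<lambda>Y. c * q Y)"
    using const
  proof (induction rule: lowdeg.induct)
    case (mem d p y)
    show ?case using lowdeg.mem[OF mem.IH, of y] by (simp add: if_distrib cong: if_cong)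
  qed (auto simp: distrib_left intro: lowdeg.intros)
  then show ?case by (rule lowdeg_mono) simp
next
  case (mem d p y)
  show ?case using lowdeg.mem[OF mem.IH[OF mem.prems], of y]
    by (simp add: if_distrib[where f = "\<lambda>a. a * _"] cong: if_cong)
qed (auto simp: distrib_right intro: lowdeg.intros)

lemma lowdeg_cnj: "lowdeg d p \<Longrightarrow> lowdeg d (\<lambda>Y. cnj (p Y))"
proof (induction rule: lowdeg.induct)
  case (mem d p y)
  show ?case using lowdeg.mem[OF mem.IH, of y] by (simp add: if_distrib cong: if_cong)
qed (auto intro: lowdeg.intros)

lemma lowdeg_sum: "(\<And>c. c \<in> C \<Longrightarrow> lowdeg d (p c)) \<Longrightarrow> lowdeg d (\<lambda>Y. \<Sum>c\<in>C. p c Y)"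
  by (induction C rule: infinite_finite_induct) (auto intro: lowdeg.intros)

lemma lowdeg_if_mem:
  assumes "lowdeg d p" "lowdeg d q"
  shows "lowdeg (Suc d) (\<lambda>Y. if y \<in> Y then p Y else q Y)"
proof -
  have "lowdeg (Suc d) (\<lambda>Y. (if y \<in> Y then p Y + (-1) * q Y else 0) + q Y)"
    using assms lowdeg_mult[OF lowdeg.const[of 0 "-1"] assms(2)]
    by (intro lowdeg.intros lowdeg_Suc) auto
  moreover have "(\<lambda>Y. (if y \<in> Y then p Y + (-1) * q Y else 0) + q Y)
      = (\<lambda>Y. if y \<in> Y then p Y else q Y)"
    by auto
  ultimately show ?thesis by simp
qed

lemma sum_Pow_insert:
  assumes "finite U" "y \<notin> U"
  shows "(\<Sum>Y\<in>Pow (insert y U). f Y) = (\<Sum>Y\<in>Pow U. f Y) + (\<Sum>Y\<in>Pow U. f (insert y Y))"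
proof -
  have "inj_on (insert y) (Pow U)"
    using assms(2) by (intro inj_onI) (metis Diff_insert_absorb PowD insertI1 insert_absorb subset_iff insert_ident)
  moreover have "Pow U \<inter> insert y ` Pow U = {}"
    using assms(2) by auto
  ultimately show ?thesis
    using assms(1) by (simp add: Pow_insert sum.union_disjoint sum.reindex)
qed

text \<open>Up to sign this is the coefficient of the monomial of \<open>U\<close>, which a low
  degree rules out. The parameter \<open>W\<close> serves the induction: in the case
  \<open>mem\<close> with \<open>y\<close> in \<open>U\<close>, only sets containing
  \<open>y\<close> contribute, and moving \<open>y\<close> from \<open>U\<close> to \<open>W\<close>
  lowers size and degree together.\<close>

lemma alternating_sum_lowdeg:
  assumes "lowdeg d p" "finite U" "card U > d" "W \<inter> U = {}"
  shows "(\<Sum>Y\<in>Pow U. (-1) ^ card Y * p (Y \<union> W)) = 0"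
  using assms
proof (induction arbitrary: U W rule: lowdeg.induct)
  case (const d c)
  then obtain y where "y \<in> U" by fastforce
  then obtain U' where U': "U = insert y U'" "y \<notin> U'" by (meson mk_disjoint_insert)
  then have "finite U'" using const by simp
  moreover have "(\<Sum>Y\<in>Pow U'. (-1) ^ card (insert y Y) * c) = (\<Sum>Y\<in>Pow U'. - ((-1) ^ card Y * c))"
  proof (intro sum.cong refl)
    fix Y assume "Y \<in> Pow U'"
    then have "finite Y" "y \<notin> Y" using U' \<open>finite U'\<close> finite_subset by auto
    then show "(-1) ^ card (insert y Y) * c = - ((-1) ^ card Y * c)" by simp
  qed
  ultimately show ?case
    using U' by (simp add: sum_Pow_insert sum_negf)
next
  case (add d p q)
  then show ?case by (simp add: distrib_left sum.distrib)
next
  case (mem d p y)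
  consider "y \<in> W" | "y \<notin> W \<union> U" | "y \<in> U" by auto
  then show ?case
  proof cases
    case 1
    then show ?thesis using mem by simp
  next
    case 2
    then have "(\<Sum>Y\<in>Pow U. (-1) ^ card Y * (if y \<in> Y \<union> W then p (Y \<union> W) else 0)) = (\<Sum>Y\<in>Pow U. 0)"
      by (intro sum.cong) auto
    then show ?thesis by simp
  next
    case 3
    then obtain U' where U': "U = insert y U'" "y \<notin> U'" by (meson mk_disjoint_insert)
    have fin: "finite U'" and y: "y \<notin> W" using mem U' by auto
    have 0: "(\<Sum>Y\<in>Pow U'. (-1) ^ card Y * (if y \<in> Y \<union> W then p (Y \<union> W) else 0)) = 0"
      using U' y by (intro sum.neutral) auto
    have "(\<Sum>Y\<in>Pow U'. (-1) ^ card (insert y Y) * p (insert y Y \<union> W))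
        = (\<Sum>Y\<in>Pow U'. - ((-1) ^ card Y * p (Y \<union> insert y W)))"
    proof (intro sum.cong refl)
      fix Y assume "Y \<in> Pow U'"
      then have "finite Y" "y \<notin> Y" using U' fin finite_subset by auto
      then show "(-1) ^ card (insert y Y) * p (insert y Y \<union> W) = - ((-1) ^ card Y * p (Y \<union> insert y W))"
        by simp
    qed
    also have "\<dots> = 0"
      using mem.IH[of U' "insert y W"] mem.prems U' fin by (simp add: sum_negf)
    finally show ?thesis
      using U' fin 0 by (simp add: sum_Pow_insert)
  qed
qed

text \<open>Several bits may share a variable, so that one variable can govern both directions of an
  edge.\<close>

definition literal :: "('a set \<Rightarrow> 'j \<Rightarrow> bool) \<Rightarrow> bool" where
  "literal \<xi> \<longleftrightarrow> (\<forall>j. (\<exists>b. \<forall>Y. \<xi> Y j = b) \<or> (\<exists>y. \<forall>Y. \<xi> Y j = (y \<in> Y)))"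

text \<open>An amplitude after the query is one of two old amplitudes, selected by a single input
  bit, so at most one variable is multiplied in.\<close>

lemma lowdeg_query:
  assumes "literal \<xi>" "\<And>a. lowdeg d (\<lambda>Y. \<psi> Y a)"
  shows "lowdeg (Suc d) (\<lambda>Y. query (\<xi> Y) (\<psi> Y) a)"
proof -
  obtain j b z where a: "a = (j, b, z)" by (metis prod_cases3)
  consider (c) v where "\<And>Y. \<xi> Y j = v" | (y) y where "\<And>Y. \<xi> Y j = (y \<in> Y)"
    using assms(1) unfolding literal_def by metis
  then show ?thesis
  proof cases
    case c
    then show ?thesis using assms(2) by (simp add: a query_def lowdeg_Suc)
  next
    case y
    have "(\<lambda>Y. query (\<xi> Y) (\<psi> Y) a) = (\<lambda>Y. if y \<in> Y then \<psi> Y (j, \<not> b, z) else \<psi> Y (j, b, z))"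
      by (auto simp: a query_def y)
    then show ?thesis using lowdeg_if_mem[OF assms(2) assms(2)] by simp
  qed
qed

lemma lowdeg_apply_oper:
  assumes "\<And>a. lowdeg d (\<lambda>Y. \<psi> Y a)"
  shows "lowdeg d (\<lambda>Y. apply_oper B U (\<psi> Y) a)"
  unfolding apply_oper_def
  by (rule lowdeg_sum) (use lowdeg_mult[OF lowdeg.const[of 0] assms] in simp)

lemma lowdeg_run:
  assumes "literal \<xi>"
  shows "lowdeg T (\<lambda>Y. run B U s (\<xi> Y) T a)"
proof (induction T arbitrary: a)
  case 0
  show ?case by (simp add: lowdeg.const)
next
  case (Suc T)
  then show ?case
    using lowdeg_apply_oper[where \<psi> = "\<lambda>Y. query (\<xi> Y) (run B U s (\<xi> Y) T)"] lowdeg_query[OF assms]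
    by simp
qed

lemma lowdeg_output_prob:
  assumes "\<And>a. lowdeg d (\<lambda>Y. \<psi> Y a)"
  shows "lowdeg (2 * d) (\<lambda>Y. complex_of_real (output_prob B A (\<psi> Y) v))"
  unfolding output_prob_def of_real_sum complex_norm_square mult_2
  by (intro lowdeg_sum lowdeg_mult lowdeg_cnj assms)

text \<open>On subsets of \<open>X\<close>, the acceptance probability is the indicator of
  acceptance, and as a sum of squared amplitudes it has degree at most 2T. If \<open>X\<close> had
  more than 2T elements, the alternating sum would vanish; but it is a sum of an odd number of terms
  1 and -1.\<close>

lemma exactly_computable_lower_bound:
  assumes "exactly_computable J f T" "finite J" "finite X" "literal \<xi>"
    and inp: "\<And>Y. Y \<subseteq> X \<Longrightarrow> \<xi> Y \<in> inputs J"
    and odd: "odd (card {Y. Y \<subseteq> X \<and> f (\<xi> Y)})"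
  shows "card X \<le> 2 * T"
proof (rule ccontr)
  assume less: "\<not> card X \<le> 2 * T"
  obtain m s U A where alg: "s \<in> basis J m" "\<And>t. t \<le> T \<Longrightarrow> unitary_on (basis J m) (U t)"
    "\<And>x. x \<in> inputs J \<Longrightarrow> output_prob (basis J m) A (run (basis J m) U s x T) (f x) = 1"
    using assms(1) unfolding exactly_computable_def by blast
  define p where "p Y = output_prob (basis J m) A (run (basis J m) U s (\<xi> Y) T) True" for Y
  have p: "p Y = of_bool (f (\<xi> Y))" if "Y \<subseteq> X" for Y
    unfolding p_def using assms(2) inp[OF that] alg
    by (intro output_prob_True) (auto intro: run_norm)
  have "lowdeg (2 * T) (\<lambda>Y. complex_of_real (p Y))"
    unfolding p_def by (intro lowdeg_output_prob lowdeg_run assms)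
  from alternating_sum_lowdeg[OF this assms(3), of "{}"] less
  have "(\<Sum>Y\<in>Pow X. (-1) ^ card Y * complex_of_real (p Y)) = 0" by simp
  also have "(\<Sum>Y\<in>Pow X. (-1) ^ card Y * complex_of_real (p Y))
      = (\<Sum>Y\<in>Pow X. if f (\<xi> Y) then (-1) ^ card Y else 0)"
    by (intro sum.cong refl) (simp add: p)
  also have "\<dots> = (\<Sum>Y\<in>{Y. Y \<subseteq> X \<and> f (\<xi> Y)}. (-1) ^ card Y)"
    using assms(3) by (subst sum.inter_filter[symmetric]) (auto intro: sum.cong)
  also have "\<dots> = of_int (\<Sum>Y\<in>{Y. Y \<subseteq> X \<and> f (\<xi> Y)}. (-1) ^ card Y)"
    by simp
  finally have "(\<Sum>Y\<in>{Y. Y \<subseteq> X \<and> f (\<xi> Y)}. (-1) ^ card Y) = (0::int)"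
    by (simp only: of_int_eq_0_iff)
  moreover have "finite {Y. Y \<subseteq> X \<and> f (\<xi> Y)}"
    by (rule finite_subset[of _ "Pow X"]) (auto simp: assms(3))
  then have "even (\<Sum>Y\<in>{Y. Y \<subseteq> X \<and> f (\<xi> Y)}. (-1) ^ card Y :: int)
      \<longleftrightarrow> even (card {Y. Y \<subseteq> X \<and> f (\<xi> Y)})"
    by (subst even_sum_iff) auto
  ultimately show False using odd by simp
qed

section \<open>Parity of fixed points of commuting involutions\<close>

lemma even_card_fixed_points:
  assumes "finite S" "\<And>y. y \<in> S \<Longrightarrow> \<tau> y \<in> S" "\<And>y. y \<in> S \<Longrightarrow> \<tau> (\<tau> y) = y"
  shows "even (card {y \<in> S. \<tau> y = y}) \<longleftrightarrow> even (card S)"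
proof -
  let ?M = "{y \<in> S. \<tau> y \<noteq> y}"
  have "2 dvd card (\<Union> ((\<lambda>y. {y, \<tau> y}) ` ?M))"
  proof (rule dvd_partition)
    show "finite (\<Union> ((\<lambda>y. {y, \<tau> y}) ` ?M))" using assms(1) by auto
    show "\<forall>c1\<in>(\<lambda>y. {y, \<tau> y}) ` ?M. \<forall>c2\<in>(\<lambda>y. {y, \<tau> y}) ` ?M. c1 \<noteq> c2 \<longrightarrow> c1 \<inter> c2 = {}"
      using assms(3) by (auto; metis)
  qed (auto simp: card_insert_if)
  moreover have "\<Union> ((\<lambda>y. {y, \<tau> y}) ` ?M) = ?M"
    using assms by auto
  ultimately have "even (card ?M)" by simp
  moreover have "card S = card {y \<in> S. \<tau> y = y} + card ?M"
    using assms(1) by (subst card_Un_disjoint[symmetric]) (auto intro: arg_cong[where f = card])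
  ultimately show ?thesis by simp
qed

text \<open>Commutation makes the common fixed points of the earlier involutions invariant under the
  next one, so the single-involution count applies again.\<close>

lemma even_card_common_fixed_points:
  assumes "finite T" "finite S"
    and "\<And>\<tau> y. \<tau> \<in> T \<Longrightarrow> y \<in> S \<Longrightarrow> \<tau> y \<in> S" "\<And>\<tau> y. \<tau> \<in> T \<Longrightarrow> y \<in> S \<Longrightarrow> \<tau> (\<tau> y) = y"
    and "\<And>\<tau> \<tau>' y. \<tau> \<in> T \<Longrightarrow> \<tau>' \<in> T \<Longrightarrow> y \<in> S \<Longrightarrow> \<tau> (\<tau>' y) = \<tau>' (\<tau> y)"
  shows "even (card {y \<in> S. \<forall>\<tau>\<in>T. \<tau> y = y}) \<longleftrightarrow> even (card S)"
  using assms
proof (induction T rule: finite_induct)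
  case empty
  then show ?case by simp
next
  case (insert \<tau> T)
  let ?S = "{y \<in> S. \<forall>\<tau>\<in>T. \<tau> y = y}"
  have "even (card {y \<in> ?S. \<tau> y = y}) \<longleftrightarrow> even (card ?S)"
  proof (rule even_card_fixed_points)
    fix y assume y: "y \<in> ?S"
    have "\<tau>' (\<tau> y) = \<tau> y" if "\<tau>' \<in> T" for \<tau>'
    proof -
      have "\<tau>' (\<tau> y) = \<tau> (\<tau>' y)" "\<tau>' y = y"
        using insert.prems(4)[of \<tau>' \<tau> y] y that by auto
      then show ?thesis by (simp only:)
    qed
    then show "\<tau> y \<in> ?S" using y insert.prems(2) by simp
  qed (use insert.prems in auto)
  also have "\<dots> \<longleftrightarrow> even (card S)"
    by (rule insert.IH) (use insert.prems in auto)
  also have "{y \<in> ?S. \<tau> y = y} = {y \<in> S. \<forall>\<tau>\<in>insert \<tau> T. \<tau> y = y}"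
    by auto
  finally show ?case .
qed

text \<open>Symmetric difference with \<open>{c}\<close>: the subsets of a set form a vector space
  over the field with two elements, and the flips are the translations by basis vectors.\<close>

definition flip :: "'c \<Rightarrow> 'c set \<Rightarrow> 'c set" where
  "flip c u = u - {c} \<union> ({c} - u)"

lemma flip_flip [simp]: "flip c (flip c u) = u"
  by (auto simp: flip_def)

lemma flip_commute: "flip c (flip d u) = flip d (flip c u)"
  by (auto simp: flip_def)

lemma flip_subset [simp]: "c \<in> K \<Longrightarrow> flip c u \<subseteq> K \<longleftrightarrow> u \<subseteq> K"
  by (auto simp: flip_def)

lemma flip_Int_eq: "flip c u \<inter> S = flip c v \<inter> S \<longleftrightarrow> u \<inter> S = v \<inter> S"
  unfolding flip_def set_eq_iff by blast

definition flip_fst :: "'c \<Rightarrow> ('c set \<times> 'c set) set \<Rightarrow> ('c set \<times> 'c set) set" where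
  "flip_fst c Y = {(u, v). (flip c u, v) \<in> Y}"

definition flip_snd :: "'c \<Rightarrow> ('c set \<times> 'c set) set \<Rightarrow> ('c set \<times> 'c set) set" where
  "flip_snd c Y = {(u, v). (u, flip c v) \<in> Y}"

lemma flip_fst_flip_fst [simp]: "flip_fst c (flip_fst c Y) = Y"
  and flip_snd_flip_snd [simp]: "flip_snd c (flip_snd c Y) = Y"
  by (auto simp: flip_fst_def flip_snd_def)

lemma flip_fst_subset: "c \<in> K \<Longrightarrow> Y \<subseteq> Pow K \<times> Pow K \<Longrightarrow> flip_fst c Y \<subseteq> Pow K \<times> Pow K"
  and flip_snd_subset: "c \<in> K \<Longrightarrow> Y \<subseteq> Pow K \<times> Pow K \<Longrightarrow> flip_snd c Y \<subseteq> Pow K \<times> Pow K"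
  by (force simp: flip_fst_def flip_snd_def)+

text \<open>This is transitivity: every finite subset is reached from \<open>{}\<close> by flipping
  its elements one at a time.\<close>

lemma flip_invariant_imp_const:
  assumes "finite u" "u \<subseteq> K" "\<And>c w. c \<in> K \<Longrightarrow> Q (flip c w) = Q w"
  shows "Q u = Q {}"
  using assms(1,2)
proof (induction u rule: finite_induct)
  case (insert c u)
  then have "flip c u = insert c u" by (auto simp: flip_def)
  then show ?case using insert assms(3)[of c u] by simp
qed simp

text \<open>The flips generate an elementary abelian 2-group that acts transitively on the pairs, so only
  the empty and the full set are fixed.\<close>

lemma odd_card_flip_invariant:
  assumes "finite K" "\<not> g {}" "g (Pow K \<times> Pow K)"
    and fst: "\<And>c Y. c \<in> K \<Longrightarrow> Y \<subseteq> Pow K \<times> Pow K \<Longrightarrow> g Y \<Longrightarrow> g (flip_fst c Y)"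
    and snd: "\<And>c Y. c \<in> K \<Longrightarrow> Y \<subseteq> Pow K \<times> Pow K \<Longrightarrow> g Y \<Longrightarrow> g (flip_snd c Y)"
  shows "odd (card {Y. Y \<subseteq> Pow K \<times> Pow K \<and> g Y})"
proof -
  let ?S = "{Y. Y \<subseteq> Pow K \<times> Pow K \<and> g Y}" and ?T = "flip_fst ` K \<union> flip_snd ` K"
  have "even (card {Y \<in> ?S. \<forall>\<tau>\<in>?T. \<tau> Y = Y}) \<longleftrightarrow> even (card ?S)"
  proof (rule even_card_common_fixed_points)
    show "finite ?S"
      by (rule finite_subset[of _ "Pow (Pow K \<times> Pow K)"]) (auto simp: assms(1))
    show "\<tau> Y \<in> ?S" if \<tau>: "\<tau> \<in> ?T" and "Y \<in> ?S" for \<tau> Y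
    proof -
      have Y: "Y \<subseteq> Pow K \<times> Pow K" "g Y" using \<open>Y \<in> ?S\<close> by auto
      from \<tau> consider c where "c \<in> K" "\<tau> = flip_fst c" | c where "c \<in> K" "\<tau> = flip_snd c"
        by auto
      then show ?thesis
        by cases (simp_all add: fst[OF _ Y] snd[OF _ Y] flip_fst_subset[OF _ Y(1)] flip_snd_subset[OF _ Y(1)])
    qed
    show "\<tau> (\<tau>' Y) = \<tau>' (\<tau> Y)" if "\<tau> \<in> ?T" "\<tau>' \<in> ?T" for \<tau> \<tau>' Y
      using that by (auto simp: flip_fst_def flip_snd_def flip_commute)
  qed (auto simp: assms(1))
  moreover have "{Y \<in> ?S. \<forall>\<tau>\<in>?T. \<tau> Y = Y} = {Pow K \<times> Pow K}"
  proof (intro equalityI subsetI)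
    fix Y assume Y: "Y \<in> {Y \<in> ?S. \<forall>\<tau>\<in>?T. \<tau> Y = Y}"
    have f: "(flip c u, v) \<in> Y \<longleftrightarrow> (u, v) \<in> Y" if "c \<in> K" for c u v
    proof -
      have "flip_fst c Y = Y" using Y that by auto
      then show ?thesis by (auto simp: flip_fst_def)
    qed
    have s: "(u, flip c v) \<in> Y \<longleftrightarrow> (u, v) \<in> Y" if "c \<in> K" for c u v
    proof -
      have "flip_snd c Y = Y" using Y that by auto
      then show ?thesis by (auto simp: flip_snd_def)
    qed
    have eq: "(u, v) \<in> Y \<longleftrightarrow> ({}, {}) \<in> Y" if "u \<subseteq> K" "v \<subseteq> K" for u v
    proof -
      have "finite u" "finite v" using that assms(1) finite_subset by auto
      then show ?thesis
        using flip_invariant_imp_const[of u K "\<lambda>w. (w, v) \<in> Y"]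
          flip_invariant_imp_const[of v K "\<lambda>w. ({}, w) \<in> Y"] that f s by auto
    qed
    have "Y \<noteq> {}" "Y \<subseteq> Pow K \<times> Pow K" using Y assms(2) by auto
    then obtain u v where "(u, v) \<in> Y" "u \<subseteq> K" "v \<subseteq> K" by fastforce
    then have "({}, {}) \<in> Y" using eq[of u v] by simp
    then have "(a, b) \<in> Y" if "a \<subseteq> K" "b \<subseteq> K" for a b using eq[OF that] by simp
    then have "Pow K \<times> Pow K \<subseteq> Y" by auto
    with \<open>Y \<subseteq> Pow K \<times> Pow K\<close> show "Y \<in> {Pow K \<times> Pow K}" by simp
  next
    fix Y assume "Y \<in> {Pow K \<times> Pow K}"
    then have "Y = Pow K \<times> Pow K" by simp
    then show "Y \<in> {Y \<in> ?S. \<forall>\<tau>\<in>?T. \<tau> Y = Y}"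
      using assms(3) by (auto simp: flip_fst_def flip_snd_def dest: subsetD)
  qed
  ultimately show ?thesis by simp
qed

section \<open>Restrictions with an odd number of accepted inputs\<close>

text \<open>A preimage rather than an image, to match the direction of
  \<open>relabel\<close>.\<close>

definition pullback :: "('v \<Rightarrow> 'v) \<Rightarrow> ('v \<times> 'v) set \<Rightarrow> ('v \<times> 'v) set" where
  "pullback \<pi> E = {(i, j). (\<pi> i, \<pi> j) \<in> E}"

lemma pullback_Un: "pullback \<pi> (E \<union> E') = pullback \<pi> E \<union> pullback \<pi> E'"
  by (auto simp: pullback_def)

text \<open>Graphs are taken with all loops: \<open>Id\<close> is the empty graph and \<open>V \<times> V\<close> the complete one.\<close>

definition nontrivial_property :: "'v set \<Rightarrow> (('v \<times> 'v) set \<Rightarrow> bool) \<Rightarrow> bool" where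
  "nontrivial_property V F \<longleftrightarrow>
     mono F \<and> (\<forall>\<pi> E. \<pi> permutes V \<longrightarrow> F (pullback \<pi> E) = F E) \<and> \<not> F Id \<and> F (V \<times> V)"

text \<open>The variables have a fixed type because types cannot be quantified existentially. Pairs
  of sets of naturals fit the use below, where both ends of a free edge are labelled by
  sets.\<close>

definition odd_substitution :: "nat \<Rightarrow> (('v \<times> 'v) set \<Rightarrow> bool) \<Rightarrow> bool" where
  "odd_substitution N F \<longleftrightarrow>
     (\<exists>(X :: (nat set \<times> nat set) set) E. finite X \<and> card X = N \<and> literal (\<lambda>Y e. e \<in> E Y) \<and>
        odd (card {Y. Y \<subseteq> X \<and> F (E Y)}))"

text \<open>Here \<alpha> and \<beta> label two vertex classes. Including both directions makes an
  exchange of the classes a mere converse of \<open>Y\<close>, so claims about the first class carry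
  over to the second.\<close>

definition bip :: "('c \<Rightarrow> 'v) \<Rightarrow> ('c \<Rightarrow> 'v) \<Rightarrow> ('c \<times> 'c) set \<Rightarrow> ('v \<times> 'v) set" where
  "bip \<alpha> \<beta> Y = {(\<alpha> u, \<beta> v) | u v. (u, v) \<in> Y} \<union> {(\<beta> v, \<alpha> u) | u v. (u, v) \<in> Y}"

lemma bip_converse: "bip \<beta> \<alpha> (Y\<inverse>) = bip \<alpha> \<beta> Y"
  by (auto simp: bip_def)

definition acts_as_flip :: "'c set \<Rightarrow> ('c set \<Rightarrow> 'v) \<Rightarrow> 'c \<Rightarrow> ('v \<Rightarrow> 'v) \<Rightarrow> bool" where
  "acts_as_flip K \<alpha> c \<pi> \<longleftrightarrow>
     \<pi> permutes \<alpha> ` Pow K \<and> (\<forall>u. u \<subseteq> K \<longrightarrow> \<pi> (\<alpha> u) = \<alpha> (flip c u))"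

lemma ex_acts_as_flip:
  assumes "inj_on \<alpha> (Pow K)" "c \<in> K"
  shows "\<exists>\<pi>. acts_as_flip K \<alpha> c \<pi>"
proof -
  define \<pi> where "\<pi> x = (if x \<in> \<alpha> ` Pow K then \<alpha> (flip c (inv_into (Pow K) \<alpha> x)) else x)" for x
  have \<pi>: "\<pi> (\<alpha> u) = \<alpha> (flip c u)" if "u \<subseteq> K" for u
    using assms that by (simp add: \<pi>_def)
  have "bij_betw \<pi> (\<alpha> ` Pow K) (\<alpha> ` Pow K)"
    using assms(2) by (intro bij_betwI[of _ _ _ \<pi>]) (auto simp: \<pi>)
  then have "\<pi> permutes \<alpha> ` Pow K"
    by (rule bij_imp_permutes) (simp add: \<pi>_def)
  with \<pi> show ?thesis by (auto simp: acts_as_flip_def)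
qed

lemma pullback_bip:
  assumes "acts_as_flip K \<alpha> c \<pi>" "c \<in> K" "\<alpha> ` Pow K \<inter> \<beta> ` Pow K = {}"
    "inj_on \<alpha> (Pow K)" "Y \<subseteq> Pow K \<times> Pow K"
  shows "pullback \<pi> (bip \<alpha> \<beta> Y) = bip \<alpha> \<beta> (flip_fst c Y)"
proof -
  have \<pi>: "\<pi> permutes \<alpha> ` Pow K" "\<And>u. u \<subseteq> K \<Longrightarrow> \<pi> (\<alpha> u) = \<alpha> (flip c u)"
    using assms(1) by (auto simp: acts_as_flip_def)
  have \<alpha>: "\<pi> i = \<alpha> u \<longleftrightarrow> i = \<alpha> (flip c u)" if "u \<subseteq> K" for i u
    using \<pi>(2)[of "flip c u"] permutes_inj[OF \<pi>(1)] that assms(2) by (auto simp: inj_def)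
  have \<beta>: "\<pi> j = \<beta> v \<longleftrightarrow> j = \<beta> v" if "v \<subseteq> K" for j v
  proof -
    have "\<beta> v \<notin> \<alpha> ` Pow K" using that assms(3) by auto
    then have "\<pi> (\<beta> v) = \<beta> v" by (rule permutes_not_in[OF \<pi>(1)])
    then show ?thesis using permutes_inj[OF \<pi>(1)] by (auto simp: inj_def)
  qed
  have "(i, j) \<in> pullback \<pi> (bip \<alpha> \<beta> Y) \<longleftrightarrow> (i, j) \<in> bip \<alpha> \<beta> (flip_fst c Y)" for i j
  proof -
    have "(i, j) \<in> pullback \<pi> (bip \<alpha> \<beta> Y) \<longleftrightarrow>
        (\<exists>u v. (u, v) \<in> Y \<and> (\<pi> i = \<alpha> u \<and> \<pi> j = \<beta> v \<or> \<pi> i = \<beta> v \<and> \<pi> j = \<alpha> u))"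
      by (auto simp: pullback_def bip_def)
    also have "\<dots> \<longleftrightarrow> (\<exists>u v. (u, v) \<in> Y \<and>
        (i = \<alpha> (flip c u) \<and> j = \<beta> v \<or> i = \<beta> v \<and> j = \<alpha> (flip c u)))"
    proof (intro ex_cong1 conj_cong refl)
      fix u v assume "(u, v) \<in> Y"
      then have "u \<subseteq> K" "v \<subseteq> K" using assms(5) by auto
      then show "(\<pi> i = \<alpha> u \<and> \<pi> j = \<beta> v \<or> \<pi> i = \<beta> v \<and> \<pi> j = \<alpha> u) \<longleftrightarrow>
          (i = \<alpha> (flip c u) \<and> j = \<beta> v \<or> i = \<beta> v \<and> j = \<alpha> (flip c u))"
        by (simp only: \<alpha> \<beta>)
    qed
    also have "\<dots> \<longleftrightarrow> (i, j) \<in> bip \<alpha> \<beta> (flip_fst c Y)"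
      by (auto simp: bip_def flip_fst_def) (metis flip_flip)+
    finally show ?thesis .
  qed
  then show ?thesis by auto
qed

text \<open>The vertex permutation behind the flip fixes \<open>G\<close> and turns the free edges
  of \<open>Y\<close> into those of \<open>flip_fst c Y\<close>; the rest is invariance of
  \<open>F\<close> under relabelling.\<close>

lemma invariant_flip_fst:
  assumes "nontrivial_property V F" "\<alpha> ` Pow K \<subseteq> V" "\<alpha> ` Pow K \<inter> \<beta> ` Pow K = {}"
    and "inj_on \<alpha> (Pow K)" "c \<in> K" "Y \<subseteq> Pow K \<times> Pow K"
    and G: "\<And>c \<pi>. c \<in> K \<Longrightarrow> acts_as_flip K \<alpha> c \<pi> \<Longrightarrow> pullback \<pi> G = G"
  shows "F (G \<union> bip \<alpha> \<beta> (flip_fst c Y)) = F (G \<union> bip \<alpha> \<beta> Y)"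
proof -
  obtain \<pi> where \<pi>: "acts_as_flip K \<alpha> c \<pi>"
    using ex_acts_as_flip assms(4,5) by metis
  then have "\<pi> permutes V"
    using permutes_subset assms(2) unfolding acts_as_flip_def by blast
  then have "F (pullback \<pi> (G \<union> bip \<alpha> \<beta> Y)) = F (G \<union> bip \<alpha> \<beta> Y)"
    using assms(1) by (simp add: nontrivial_property_def)
  then show ?thesis
    using pullback_bip[OF \<pi>] G[OF _ \<pi>] assms by (simp add: pullback_Un)
qed

text \<open>The common core of the two constructions below. \<open>G\<close> holds the fixed edges,
  each pair of labels is one variable, and invariance of \<open>G\<close> under flips on either
  class turns vertex symmetries into symmetries of the restricted function.\<close>

lemma odd_substitution_bip:
  fixes K :: "nat set"
  assumes "nontrivial_property V F" "finite K"
    and "inj_on \<alpha> (Pow K)" "inj_on \<beta> (Pow K)" "\<alpha> ` Pow K \<inter> \<beta> ` Pow K = {}"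
    and "\<alpha> ` Pow K \<subseteq> V" "\<beta> ` Pow K \<subseteq> V"
    and G\<alpha>: "\<And>c \<pi>. c \<in> K \<Longrightarrow> acts_as_flip K \<alpha> c \<pi> \<Longrightarrow> pullback \<pi> G = G"
    and G\<beta>: "\<And>c \<pi>. c \<in> K \<Longrightarrow> acts_as_flip K \<beta> c \<pi> \<Longrightarrow> pullback \<pi> G = G"
    and G: "\<not> F G" "F (G \<union> bip \<alpha> \<beta> (Pow K \<times> Pow K))"
  shows "odd_substitution (4 ^ card K) F"
proof -
  define X where "X = Pow K \<times> Pow K"
  \<comment> \<open>\<open>literal\<close> quantifies over all \<open>Y\<close>, while \<alpha> and
    \<beta> are injective only on \<open>Pow K\<close>; intersecting with \<open>X\<close> excludes
    pairs whose edges might coincide with those of other pairs.\<close>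
  define E where "E Y = G \<union> bip \<alpha> \<beta> (Y \<inter> X)" for Y
  have "literal (\<lambda>Y e. e \<in> E Y)"
    unfolding literal_def
  proof (intro allI)
    fix e
    show "(\<exists>b. \<forall>Y. (e \<in> E Y) = b) \<or> (\<exists>y. \<forall>Y. (e \<in> E Y) = (y \<in> Y))"
    proof (cases "e \<in> bip \<alpha> \<beta> X - G")
      case True
      then obtain u v where uv: "(u, v) \<in> X" "e = (\<alpha> u, \<beta> v) \<or> e = (\<beta> v, \<alpha> u)" "e \<notin> G"
        by (auto simp: bip_def)
      have "u' = u \<and> v' = v"
        if "(u', v') \<in> X" "e = (\<alpha> u', \<beta> v') \<or> e = (\<beta> v', \<alpha> u')" for u' v'
      proof -
        have "u \<subseteq> K" "v \<subseteq> K" "u' \<subseteq> K" "v' \<subseteq> K" using uv(1) that(1) by (auto simp: X_def)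
        moreover have "\<alpha> a \<noteq> \<beta> b" if "a \<subseteq> K" "b \<subseteq> K" for a b
          using assms(5) that by blast
        ultimately show ?thesis
          using uv(2) that(2) inj_onD[OF assms(3), of u' u] inj_onD[OF assms(4), of v' v]
          by (metis PowI prod.inject)
      qed
      then have "e \<in> bip \<alpha> \<beta> (Y \<inter> X) \<longleftrightarrow> (u, v) \<in> Y" for Y
        using uv(1,2) unfolding bip_def mem_Collect_eq Un_iff Int_iff by metis
      then have "(e \<in> E Y) = ((u, v) \<in> Y)" for Y
        using uv(3) by (simp add: E_def)
      then show ?thesis by blast
    next
      case False
      then have "(e \<in> E Y) = (e \<in> G)" for Y
        unfolding E_def bip_def by blast
      then show ?thesis by blast
    qed
  qed
  moreover have "odd (card {Y. Y \<subseteq> X \<and> F (E Y)})"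
    unfolding X_def
  proof (rule odd_card_flip_invariant)
    have EY: "E Y = G \<union> bip \<alpha> \<beta> Y" if "Y \<subseteq> Pow K \<times> Pow K" for Y
      using that by (simp add: E_def X_def Int_absorb2)
    show "\<not> F (E {})" using G(1) by (simp add: E_def bip_def)
    show "F (E (Pow K \<times> Pow K))" using G(2) by (simp add: EY)
    fix c Y assume *: "c \<in> K" "Y \<subseteq> Pow K \<times> Pow K" "F (E Y)"
    show "F (E (flip_fst c Y))"
      using * invariant_flip_fst[of V F \<alpha> K \<beta> c Y G] assms flip_fst_subset[of c K Y]
      by (simp add: EY)
    \<comment> \<open>A flip on the second class is a flip on the first once the classes are
      exchanged, so \<open>invariant_flip_fst\<close> covers it as well.\<close>
    have "flip_snd c Y = (flip_fst c (Y\<inverse>))\<inverse>"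
      by (auto simp: flip_fst_def flip_snd_def)
    then have "bip \<alpha> \<beta> (flip_snd c Y) = bip \<beta> \<alpha> (flip_fst c (Y\<inverse>))"
      by (simp add: bip_converse[of \<alpha> \<beta>])
    moreover have "Y\<inverse> \<subseteq> Pow K \<times> Pow K" using *(2) by auto
    ultimately show "F (E (flip_snd c Y))"
      using * invariant_flip_fst[of V F \<beta> K \<alpha> c "Y\<inverse>" G] assms flip_snd_subset[of c K Y]
      by (simp add: EY Int_commute bip_converse)
  qed (use assms in auto)
  moreover have "card X = 4 ^ card K"
    using assms(2) by (simp add: X_def card_cartesian_product card_Pow flip: power_mult_distrib)
  moreover have "finite X" using assms(2) by (simp add: X_def)
  ultimately show ?thesis unfolding odd_substitution_def by blast
qed


text \<open>The fixed edges form a clique on \<open>V - A\<close>. No edge between \<open>A\<close> and \<open>B\<close> leaves every vertex of \<open>A\<close>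
  isolated; all of them make every vertex of \<open>B\<close> adjacent to all others.\<close>

lemma odd_substitution_clique_star:
  assumes P: "nontrivial_property V F" and "finite V" "2 ^ Suc d \<le> card V" "w \<in> V"
    and clique: "\<not> F ((V - {w}) \<times> (V - {w}) \<union> Id)"
    and star: "F ({w} \<times> V \<union> V \<times> {w} \<union> Id)"
  shows "odd_substitution (4 ^ d) F"
proof -
  let ?K = "{..<d}"
  obtain A where A: "A \<subseteq> V" "card A = 2 ^ d" "finite A"
    using obtain_subset_with_card_n[of "2 ^ d" V] assms(3) by auto
  have "card (V - A) = card V - 2 ^ d"
    using A by (simp add: card_Diff_subset)
  then have "2 ^ d \<le> card (V - A)" using assms(3) by simp
  then obtain B where B: "B \<subseteq> V - A" "card B = 2 ^ d" "finite B"
    using obtain_subset_with_card_n by metis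
  obtain \<alpha> where \<alpha>: "bij_betw \<alpha> (Pow ?K) A"
    using finite_same_card_bij[of "Pow ?K" A] A by (auto simp: card_Pow)
  obtain \<beta> where \<beta>: "bij_betw \<beta> (Pow ?K) B"
    using finite_same_card_bij[of "Pow ?K" B] B by (auto simp: card_Pow)
  have inv: "F (pullback \<pi> E) = F E" if "\<pi> permutes V" for \<pi> E
    using P that by (auto simp: nontrivial_property_def)
  have mono: "F E'" if "F E" "E \<subseteq> E'" for E E'
    using P that by (auto simp: nontrivial_property_def mono_def)
  define G where "G = (V - A) \<times> (V - A) \<union> Id"
  have G: "pullback \<pi> G = G" if "\<pi> permutes A \<or> \<pi> permutes B" for \<pi>
  proof -
    have "\<pi> permutes V" using that A(1) B(1) by (meson Diff_subset permutes_subset subset_trans)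
    moreover have "\<pi> i \<in> A \<longleftrightarrow> i \<in> A" for i
      using that
    proof
      assume "\<pi> permutes B"
      then show ?thesis using B(1) permutes_in_image[of \<pi> B i] permutes_not_in[of \<pi> B i]
        by (cases "i \<in> B") auto
    qed (simp add: permutes_in_image)
    ultimately show ?thesis
      using permutes_inj[of \<pi> V] permutes_in_image[of \<pi> V]
      by (auto simp: G_def pullback_def inj_def)
  qed
  have "odd_substitution (4 ^ card ?K) F"
  proof (rule odd_substitution_bip[OF P, where \<alpha> = \<alpha> and \<beta> = \<beta> and G = G])
    show "pullback \<pi> G = G" if "acts_as_flip ?K \<alpha> c \<pi>" for c \<pi>
      using that \<alpha> by (intro G) (auto simp: acts_as_flip_def bij_betw_def)
    show "pullback \<pi> G = G" if "acts_as_flip ?K \<beta> c \<pi>" for c \<pi>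
      using that \<beta> by (intro G) (auto simp: acts_as_flip_def bij_betw_def)
    have "card A > 0" "card B > 0" using A(2) B(2) by simp_all
    then obtain a b where ab: "a \<in> A" "b \<in> B" by (auto simp: card_gt_0_iff)
    \<comment> \<open>The hypotheses concern \<open>w\<close>; transposing carries them to a vertex
      \<open>a\<close> of \<open>A\<close> and a vertex \<open>b\<close> of
      \<open>B\<close>.\<close>
    have tr: "transpose x w permutes V" if "x \<in> V" for x
      using assms(4) that by (simp add: permutes_swap_id)
    show "\<not> F G"
    proof
      assume "F G"
      then have "F ((V - {a}) \<times> (V - {a}) \<union> Id)"
        using ab by (elim mono) (auto simp: G_def)
      then have "F (pullback (transpose a w) ((V - {a}) \<times> (V - {a}) \<union> Id))"
        using inv tr A(1) ab(1) by blast
      moreover have "pullback (transpose a w) ((V - {a}) \<times> (V - {a}) \<union> Id) \<subseteq> (V - {w}) \<times> (V - {w}) \<union> Id"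
        using A(1) ab(1) assms(4)
        by (auto simp: pullback_def transpose_def split: if_splits)
      ultimately show False using clique mono by blast
    qed
    have "F (pullback (transpose b w) ({w} \<times> V \<union> V \<times> {w} \<union> Id))"
      using inv[OF tr[of b]] star ab(2) B(1) by blast
    moreover have "pullback (transpose b w) ({w} \<times> V \<union> V \<times> {w} \<union> Id)
        \<subseteq> G \<union> bip \<alpha> \<beta> (Pow ?K \<times> Pow ?K)"
    proof -
      have "bip \<alpha> \<beta> (Pow ?K \<times> Pow ?K) = A \<times> B \<union> B \<times> A"
        using \<alpha> \<beta> unfolding bij_betw_def bip_def by blast
      moreover have "pullback (transpose b w) ({w} \<times> V \<union> V \<times> {w} \<union> Id) \<subseteq> {b} \<times> V \<union> V \<times> {b} \<union> Id"
        using tr[of b] ab(2) B(1) permutes_in_image[of "transpose b w" V]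
        by (auto simp: pullback_def transpose_eq_iff dest: injD[OF inj_transpose])
      ultimately show ?thesis
        using B(1) ab(2) unfolding G_def by blast
    qed
    ultimately show "F (G \<union> bip \<alpha> \<beta> (Pow ?K \<times> Pow ?K))" by (rule mono)
  qed (use \<alpha> \<beta> A(1) B(1) in \<open>auto simp: bij_betw_def\<close>)
  then show ?thesis by simp
qed

text \<open>Vertices are labelled by the subsets of \<open>{..d}\<close>. The graphs in which two vertices are adjacent
  iff their labels agree from coordinate \<open>i\<close> on form a chain from the empty to the complete graph;
  between two consecutive ones, only edges are added that change coordinate \<open>i\<close>.\<close>

lemma odd_substitution_power_of_2:
  assumes P: "nontrivial_property V F" and "finite V" "card V = 2 ^ Suc d"
  shows "odd_substitution (4 ^ d) F"
proof -
  obtain \<phi> where \<phi>: "bij_betw \<phi> (Pow {..<Suc d}) V"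
    using finite_same_card_bij[of "Pow {..<Suc d}" V] assms(2,3) by (auto simp: card_Pow)
  have inj: "\<phi> u = \<phi> v \<longleftrightarrow> u = v" if "u \<subseteq> {..<Suc d}" "v \<subseteq> {..<Suc d}" for u v
    using \<phi> that by (auto simp: bij_betw_def inj_on_def)
  define D where "D i = {(\<phi> u, \<phi> v) | u v. u \<subseteq> {..<Suc d} \<and> v \<subseteq> {..<Suc d} \<and> u \<inter> {i..} = v \<inter> {i..}}" for i
  have mono: "F E'" if "F E" "E \<subseteq> E'" for E E'
    using P that by (auto simp: nontrivial_property_def mono_def)
  have "D 0 \<subseteq> Id" by (auto simp: D_def)
  then have "\<not> F (D 0)" using P mono unfolding nontrivial_property_def by blast
  moreover have "V \<times> V \<subseteq> D (Suc d)"
  proof -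
    have "u \<inter> {Suc d..} = {}" if "u \<subseteq> {..<Suc d}" for u
      using that by fastforce
    then show ?thesis using \<phi> unfolding bij_betw_def D_def by blast
  qed
  then have "F (D (Suc d))" using P mono unfolding nontrivial_property_def by blast
  ultimately obtain i where i: "i < Suc d" "\<not> F (D i)" "F (D (Suc i))"
    using dec_induct[of 0 "Suc d" "\<lambda>i. \<not> F (D i)"] by auto
  \<comment> \<open>Coordinate \<open>i\<close> splits \<open>V\<close> into two classes of equal
    size: \<phi> labels the vertices without it and \<beta> those with it, both by subsets of the
    remaining \<open>d\<close> coordinates.\<close>
  define K where "K = {..<Suc d} - {i}"
  define \<beta> where "\<beta> u = \<phi> (insert i u)" for u
  have K: "u \<subseteq> {..<Suc d}" "insert i u \<subseteq> {..<Suc d}" "i \<notin> u" if "u \<subseteq> K" for u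
    using that i(1) by (auto simp: K_def)
  have \<phi>inj: "inj_on \<phi> (Pow K)"
    using \<phi> K unfolding bij_betw_def by (auto intro: inj_on_subset)
  have \<beta>inj: "inj_on \<beta> (Pow K)"
  proof (rule inj_onI)
    fix u v assume "u \<in> Pow K" "v \<in> Pow K" "\<beta> u = \<beta> v"
    then have "insert i u = insert i v" "i \<notin> u" "i \<notin> v" using K by (auto simp: \<beta>_def inj)
    then show "u = v" by auto
  qed
  have disj: "\<phi> ` Pow K \<inter> \<beta> ` Pow K = {}"
    using K by (auto simp: \<beta>_def inj)
  have V: "\<phi> ` Pow K \<subseteq> V" "\<beta> ` Pow K \<subseteq> V"
    using \<phi> K by (auto simp: \<beta>_def bij_betw_def)
  have VK: "x \<in> V \<Longrightarrow> x \<in> \<phi> ` Pow K \<or> x \<in> \<beta> ` Pow K" for x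
  proof -
    assume "x \<in> V"
    then obtain u where u: "x = \<phi> u" "u \<subseteq> {..<Suc d}" using \<phi> by (auto simp: bij_betw_def)
    show ?thesis
    proof (cases "i \<in> u")
      case True
      then have "x = \<beta> (u - {i})" "u - {i} \<subseteq> K" using u by (auto simp: \<beta>_def K_def insert_absorb)
      then show ?thesis by auto
    next
      case False
      then show ?thesis using u by (auto simp: K_def)
    qed
  qed
  have D\<phi>: "(\<phi> u, \<phi> v) \<in> D i \<longleftrightarrow> u \<inter> {i..} = v \<inter> {i..}" if "u \<subseteq> {..<Suc d}" "v \<subseteq> {..<Suc d}" for u v
    unfolding D_def using that inj by blast
  have D_cross: "(\<phi> u, \<beta> v) \<notin> D i" "(\<beta> v, \<phi> u) \<notin> D i" if "u \<subseteq> K" "v \<subseteq> K" for u v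
  proof -
    have "i \<notin> u" using K(3)[OF that(1)] .
    then have "u \<inter> {i..} \<noteq> insert i v \<inter> {i..}" by auto
    then show "(\<phi> u, \<beta> v) \<notin> D i" "(\<beta> v, \<phi> u) \<notin> D i"
      using D\<phi>[OF K(1)[OF that(1)] K(2)[OF that(2)]] D\<phi>[OF K(2)[OF that(2)] K(1)[OF that(1)]]
      unfolding \<beta>_def by blast+
  qed
  have D_flip: "(\<phi> (flip c u), \<phi> (flip c v)) \<in> D i \<longleftrightarrow> (\<phi> u, \<phi> v) \<in> D i"
    if "c \<in> K" "u \<subseteq> K" "v \<subseteq> K" for c u v
    using D\<phi>[OF K(1)[of "flip c u"] K(1)[of "flip c v"]] D\<phi>[OF K(1)[of u] K(1)[of v]] that
    by (simp add: flip_Int_eq)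
  have D_flip': "(\<beta> (flip c u), \<beta> (flip c v)) \<in> D i \<longleftrightarrow> (\<beta> u, \<beta> v) \<in> D i"
    if "c \<in> K" "u \<subseteq> K" "v \<subseteq> K" for c u v
  proof -
    have "c \<noteq> i" using that(1) by (auto simp: K_def)
    then have "insert i (flip c w) = flip c (insert i w)" for w by (auto simp: flip_def)
    then show ?thesis
      using D\<phi>[OF K(2)[of "flip c u"] K(2)[of "flip c v"]] D\<phi>[OF K(2)[of u] K(2)[of v]] that
      by (simp add: flip_Int_eq \<beta>_def)
  qed
  have D_V: "D i \<subseteq> V \<times> V" using \<phi> by (auto simp: D_def bij_betw_def)
  \<comment> \<open>Both assignments of \<phi> and \<beta> to \<alpha> and \<alpha>' are needed. A
    flip on one class alone is harmless because \<open>D i\<close> has no edges between the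
    classes.\<close>
  have pullback_D: "pullback \<pi> (D i) = D i"
    if \<pi>: "acts_as_flip K \<alpha> c \<pi>" and "c \<in> K" and \<alpha>: "\<alpha> ` Pow K \<subseteq> V" "\<alpha> ` Pow K \<inter> \<alpha>' ` Pow K = {}"
      "\<And>x. x \<in> V \<Longrightarrow> x \<in> \<alpha> ` Pow K \<or> x \<in> \<alpha>' ` Pow K"
      and flip: "\<And>u v. u \<subseteq> K \<Longrightarrow> v \<subseteq> K \<Longrightarrow> (\<alpha> (flip c u), \<alpha> (flip c v)) \<in> D i \<longleftrightarrow> (\<alpha> u, \<alpha> v) \<in> D i"
      and cross: "\<And>u v. u \<subseteq> K \<Longrightarrow> v \<subseteq> K \<Longrightarrow> (\<alpha> u, \<alpha>' v) \<notin> D i \<and> (\<alpha>' v, \<alpha> u) \<notin> D i" for \<pi> c \<alpha> \<alpha>'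
  proof -
    have p: "\<pi> permutes \<alpha> ` Pow K" "\<And>u. u \<subseteq> K \<Longrightarrow> \<pi> (\<alpha> u) = \<alpha> (flip c u)"
      using \<pi> by (auto simp: acts_as_flip_def)
    then have pV: "\<pi> x \<in> V \<longleftrightarrow> x \<in> V" for x
      using permutes_subset[OF p(1) \<alpha>(1)] permutes_in_image by metis
    have p': "\<pi> (\<alpha>' v) = \<alpha>' v" if "v \<subseteq> K" for v
      using \<alpha>(2) that by (intro permutes_not_in[OF p(1)]) auto
    have "(\<pi> x, \<pi> y) \<in> D i \<longleftrightarrow> (x, y) \<in> D i" for x y
    proof (cases "x \<in> V \<and> y \<in> V")
      case True
      then have "x \<in> \<alpha> ` Pow K \<or> x \<in> \<alpha>' ` Pow K" "y \<in> \<alpha> ` Pow K \<or> y \<in> \<alpha>' ` Pow K"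
        using \<alpha>(3) by auto
      then show ?thesis
        using \<open>c \<in> K\<close> by (auto simp: p(2) p' flip cross)
    next
      case False
      then show ?thesis using D_V pV by blast
    qed
    then show ?thesis by (auto simp: pullback_def)
  qed
  have "odd_substitution (4 ^ card K) F"
  proof (rule odd_substitution_bip[OF P _ \<phi>inj \<beta>inj disj V, where G = "D i"])
    show "pullback \<pi> (D i) = D i" if "c \<in> K" "acts_as_flip K \<phi> c \<pi>" for c \<pi>
      using that by (intro pullback_D[where \<alpha> = \<phi> and \<alpha>' = \<beta> and c = c]) (use V disj VK D_flip D_cross in auto)
    show "pullback \<pi> (D i) = D i" if "c \<in> K" "acts_as_flip K \<beta> c \<pi>" for c \<pi>
    proof (rule pullback_D[OF that(2,1), where \<alpha>' = \<phi>])
      show "\<beta> ` Pow K \<inter> \<phi> ` Pow K = {}" using disj by (simp add: Int_commute)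
      show "x \<in> \<beta> ` Pow K \<or> x \<in> \<phi> ` Pow K" if "x \<in> V" for x using VK[OF that] by (simp add: disj_commute)
    qed (use V D_flip' D_cross that(1) in auto)
    \<comment> \<open>Inclusion is enough: the complete bipartite graph may add more cross edges
      than \<open>D (Suc i)\<close> has, and \<open>F\<close> is monotone.\<close>
    have "D (Suc i) \<subseteq> D i \<union> bip \<phi> \<beta> (Pow K \<times> Pow K)"
    proof (rule subsetI)
      fix e assume "e \<in> D (Suc i)"
      then obtain u v where uv: "e = (\<phi> u, \<phi> v)" "u \<subseteq> {..<Suc d}" "v \<subseteq> {..<Suc d}"
        "u \<inter> {Suc i..} = v \<inter> {Suc i..}"
        by (auto simp: D_def)
      have ge: "{i..} = insert i {Suc i..}" by auto
      consider "i \<in> u \<longleftrightarrow> i \<in> v" | "i \<notin> u" "i \<in> v" | "i \<in> u" "i \<notin> v" by blast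
      then show "e \<in> D i \<union> bip \<phi> \<beta> (Pow K \<times> Pow K)"
      proof cases
        case 1
        then have "u \<inter> {i..} = v \<inter> {i..}" using uv(4) by (auto simp: ge)
        then show ?thesis using uv by (auto simp: D_def)
      next
        case 2
        then have "e = (\<phi> u, \<beta> (v - {i}))" "u \<subseteq> K" "v - {i} \<subseteq> K"
          using uv by (auto simp: \<beta>_def K_def insert_absorb)
        then show ?thesis by (auto simp: bip_def)
      next
        case 3
        then have "e = (\<beta> (u - {i}), \<phi> v)" "v \<subseteq> K" "u - {i} \<subseteq> K"
          using uv by (auto simp: \<beta>_def K_def insert_absorb)
        then show ?thesis by (auto simp: bip_def)
      qed
    qed
    then show "F (D i \<union> bip \<phi> \<beta> (Pow K \<times> Pow K))" using i(3) mono by blast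
  qed (use i in \<open>auto simp: K_def\<close>)
  moreover have "card K = d" using i(1) by (simp add: K_def)
  ultimately show ?thesis by simp
qed

text \<open>The two choices of \<open>R\<close> make \<open>w\<close> isolated or adjacent to every other vertex.\<close>

lemma nontrivial_property_restrict:
  assumes P: "nontrivial_property V F" and w: "w \<in> V"
    and R: "R = Id \<or> R = {w} \<times> V \<union> V \<times> {w} \<union> Id" "\<not> F R"
      "F ((V - {w}) \<times> (V - {w}) \<union> R)"
  shows "nontrivial_property (V - {w}) (\<lambda>E. F (E \<inter> (V - {w}) \<times> (V - {w}) \<union> R))"
  unfolding nontrivial_property_def
proof (intro conjI allI impI)
  let ?W = "V - {w}"
  show "mono (\<lambda>E. F (E \<inter> ?W \<times> ?W \<union> R))"
  proof (rule monoI)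
    fix E E' :: "('a \<times> 'a) set" assume "E \<subseteq> E'"
    then show "F (E \<inter> ?W \<times> ?W \<union> R) \<le> F (E' \<inter> ?W \<times> ?W \<union> R)"
      using P unfolding nontrivial_property_def by (intro monoD[of F]) auto
  qed
  fix \<pi> E assume \<pi>: "\<pi> permutes ?W"
  then have \<pi>V: "\<pi> permutes V" using permutes_subset by blast
  have W: "\<pi> x \<in> ?W \<longleftrightarrow> x \<in> ?W" for x using permutes_in_image[OF \<pi>] by blast
  have V: "\<pi> x \<in> V \<longleftrightarrow> x \<in> V" for x using permutes_in_image[OF \<pi>V] by blast
  have "\<pi> w = w" using permutes_not_in[OF \<pi>] by blast
  then have w: "\<pi> x = w \<longleftrightarrow> x = w" for x using permutes_inj[OF \<pi>] by (metis injD)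
  have "pullback \<pi> R = R"
    using R(1) permutes_inj[OF \<pi>] V w by (auto simp: pullback_def inj_def)
  moreover have "pullback \<pi> (E \<inter> ?W \<times> ?W) = pullback \<pi> E \<inter> ?W \<times> ?W"
    using W by (auto simp: pullback_def)
  ultimately show "F (pullback \<pi> E \<inter> ?W \<times> ?W \<union> R) = F (E \<inter> ?W \<times> ?W \<union> R)"
    using P \<pi>V unfolding nontrivial_property_def by (metis pullback_Un)
next
  have "Id \<inter> (V - {w}) \<times> (V - {w}) \<union> R = R" using R(1) by auto
  then show "\<not> F (Id \<inter> (V - {w}) \<times> (V - {w}) \<union> R)" using R(2) by simp
qed (use R(3) in simp)

text \<open>Intersecting with \<open>S\<close> and adding \<open>R\<close> leaves each edge as it
  was or makes it constant, so literals stay literals.\<close>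

lemma odd_substitution_restrict:
  assumes "odd_substitution N (\<lambda>E. F (E \<inter> S \<union> R))"
  shows "odd_substitution N F"
proof -
  obtain X :: "(nat set \<times> nat set) set" and E where E: "finite X" "card X = N"
    "literal (\<lambda>Y e. e \<in> E Y)" "odd (card {Y. Y \<subseteq> X \<and> F (E Y \<inter> S \<union> R)})"
    using assms unfolding odd_substitution_def by auto
  have "literal (\<lambda>Y e. e \<in> E Y \<inter> S \<union> R)"
    unfolding literal_def
  proof
    fix e
    show "(\<exists>b. \<forall>Y. (e \<in> E Y \<inter> S \<union> R) = b) \<or> (\<exists>y. \<forall>Y. (e \<in> E Y \<inter> S \<union> R) = (y \<in> Y))"
    proof (cases "e \<in> S - R")
      case True
      then show ?thesis
        using E(3)[unfolded literal_def, THEN spec, of e] by (simp del: split_paired_Ex)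
    qed blast
  qed
  then show ?thesis
    unfolding odd_substitution_def using E
    by (intro exI[of _ X] exI[of _ "\<lambda>Y. E Y \<inter> S \<union> R"]) auto
qed

text \<open>Induction on the number of excess vertices. Making \<open>w\<close> isolated keeps the
  property nontrivial if the clique on the other vertices is accepted; making \<open>w\<close>
  adjacent to all does so if the star of \<open>w\<close> is rejected. In the remaining case,
  \<open>odd_substitution_clique_star\<close> applies at once.\<close>

lemma odd_substitution_nontrivial_property:
  assumes "nontrivial_property V F" "finite V" "2 ^ Suc d \<le> card V"
  shows "odd_substitution (4 ^ d) F"
  using assms(2,3,1)
proof (induction "card V - 2 ^ Suc d" arbitrary: V F)
  case 0
  then show ?case by (intro odd_substitution_power_of_2) auto
next
  case (Suc n)
  then obtain w where w: "w \<in> V" by fastforce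
  let ?W = "V - {w}" and ?star = "{w} \<times> V \<union> V \<times> {w} \<union> Id"
  have W: "n = card ?W - 2 ^ Suc d" "finite ?W" "2 ^ Suc d \<le> card ?W"
    using Suc w by auto
  have Id: "\<not> F Id" using Suc.prems(3) by (simp add: nontrivial_property_def)
  have "V \<times> V \<subseteq> ?W \<times> ?W \<union> ?star" by auto
  then have top: "F (?W \<times> ?W \<union> ?star)"
    using Suc.prems(3) unfolding nontrivial_property_def mono_def by (metis le_boolD)
  show ?case
  proof (cases "F (?W \<times> ?W \<union> Id)")
    case True
    then show ?thesis
      using Suc.hyps(1)[OF W nontrivial_property_restrict[OF Suc.prems(3) w _ Id]]
      by (auto intro: odd_substitution_restrict)
  next
    case clique: False
    show ?thesis
    proof (cases "F ?star")
      case True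
      then show ?thesis by (rule odd_substitution_clique_star[OF Suc.prems(3,1,2) w clique])
    next
      case False
      then show ?thesis
        using Suc.hyps(1)[OF W nontrivial_property_restrict[OF Suc.prems(3) w _ False top]]
        by (auto intro: odd_substitution_restrict)
    qed
  qed
qed


section \<open>From substitutions to the quadratic lower bound on \<open>Q_E\<close>\<close>

lemma nontrivial_property_if_nonconst_monotone:
  assumes "nonconst_monotone_graph_property n P"
  shows "nontrivial_property {..<n} (\<lambda>E. P (restrict (\<lambda>e. e \<in> E) (edges n)))"
proof -
  let ?x = "\<lambda>E. restrict (\<lambda>e. e \<in> E) (edges n)"
  have inp: "?x E \<in> inputs (edges n)" for E by (simp add: inputs_def)
  have inv: "\<pi> permutes {..<n} \<Longrightarrow> x \<in> inputs (edges n) \<Longrightarrow> P (relabel n \<pi> x) = P x"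
    and mono: "x \<in> inputs (edges n) \<Longrightarrow> y \<in> inputs (edges n) \<Longrightarrow> x \<le> y \<Longrightarrow> P x \<le> P y"
    and range: "P ` inputs (edges n) = {False, True}" for \<pi> x y
    using assms by (auto simp: nonconst_monotone_graph_property_def graph_property_def mono_on_def)
  have le: "?x E \<le> ?x E'" if "E \<subseteq> E'" for E E'
    using that by (auto simp: le_fun_def)
  have out: "x e = undefined" if "x \<in> inputs (edges n)" "e \<notin> edges n" for x e
    using that by (auto simp: inputs_def)
  \<comment> \<open>Restriction to \<open>edges n\<close> discards loops, so \<open>Id\<close> and
    the full square become the least and the greatest input; by monotonicity a non-constant property
    separates them.\<close>
  have Id: "?x Id \<le> x" if "x \<in> inputs (edges n)" for x
    unfolding le_fun_def
  proof
    fix e show "?x Id e \<le> x e"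
      using out[OF that, of e] by (cases e) (auto simp: edges_def)
  qed
  have UNIV: "x \<le> ?x ({..<n} \<times> {..<n})" if "x \<in> inputs (edges n)" for x
    unfolding le_fun_def
  proof
    fix e show "x e \<le> ?x ({..<n} \<times> {..<n}) e"
      using out[OF that, of e] by (cases e) (auto simp: edges_def)
  qed
  obtain x y where xy: "x \<in> inputs (edges n)" "y \<in> inputs (edges n)" "\<not> P x" "P y"
  proof -
    have "False \<in> P ` inputs (edges n)" "True \<in> P ` inputs (edges n)" by (simp_all add: range)
    then show ?thesis using that by blast
  qed
  show ?thesis
    unfolding nontrivial_property_def
  proof (intro conjI allI impI)
    show "mono (\<lambda>E. P (?x E))" by (intro monoI mono inp le)
    show "\<not> P (?x Id)" using mono[OF inp xy(1) Id[OF xy(1)]] xy(3) by simp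
    show "P (?x ({..<n} \<times> {..<n}))" using mono[OF xy(2) inp UNIV[OF xy(2)]] xy(4) by simp
    fix \<pi> E assume \<pi>: "\<pi> permutes {..<n}"
    have "(\<pi> i, \<pi> j) \<in> edges n \<longleftrightarrow> (i, j) \<in> edges n" for i j
      using permutes_in_image[OF \<pi>] permutes_inj[OF \<pi>] by (auto simp: edges_def inj_def)
    then have "relabel n \<pi> (?x E) = ?x (pullback \<pi> E)"
      by (auto simp: relabel_def pullback_def restrict_def)
    then show "P (?x (pullback \<pi> E)) = P (?x E)"
      using inv[OF \<pi> inp[of E]] by simp
  qed
qed

lemma power_le_exactly_computable:
  assumes "nonconst_monotone_graph_property n P" "2 ^ Suc d \<le> n"
    and "exactly_computable (edges n) P T"
  shows "4 ^ d \<le> 2 * T"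
proof -
  let ?x = "\<lambda>E. restrict (\<lambda>e. e \<in> E) (edges n)"
  have "odd_substitution (4 ^ d) (\<lambda>E. P (?x E))"
    using nontrivial_property_if_nonconst_monotone[OF assms(1)] assms(2)
    by (intro odd_substitution_nontrivial_property) auto
  then obtain X :: "(nat set \<times> nat set) set" and E where E: "finite X" "card X = 4 ^ d"
    "literal (\<lambda>Y e. e \<in> E Y)" "odd (card {Y. Y \<subseteq> X \<and> P (?x (E Y))})"
    unfolding odd_substitution_def by auto
  have "literal (\<lambda>Y. ?x (E Y))"
    unfolding literal_def
  proof
    fix e
    show "(\<exists>b. \<forall>Y. ?x (E Y) e = b) \<or> (\<exists>y. \<forall>Y. ?x (E Y) e = (y \<in> Y))"
      using E(3)[unfolded literal_def, THEN spec, of e]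
      by (cases "e \<in> edges n") (simp_all del: split_paired_Ex)
  qed
  then have "card X \<le> 2 * T"
    by (rule exactly_computable_lower_bound[OF assms(3) finite_edges E(1)])
      (simp_all add: E(4) inputs_def)
  then show ?thesis using E(2) by simp
qed

text \<open>Choosing \<open>d\<close> with 2^(d+1) \<le> n < 2^(d+2) gives n^2 < 16 * 4^d, and 4^d
  is at most 2T. Such a \<open>d\<close> exists because n is at least 2.\<close>

lemma square_le_exactly_computable:
  assumes "nonconst_monotone_graph_property n P" "2 \<le> n"
    and "exactly_computable (edges n) P T"
  shows "n\<^sup>2 \<le> 32 * T"
proof -
  obtain k where k: "2 ^ k \<le> n" "n < 2 ^ (k + 1)"
    using ex_power_ivl1[of 2 n] assms(2) by auto
  then obtain d where d: "k = Suc d" using assms(2) by (cases k) auto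
  have "n\<^sup>2 \<le> (2 ^ (k + 1))\<^sup>2" using k(2) by (intro power_mono) auto
  also have "\<dots> = 16 * (2 ^ d * 2 ^ d)" unfolding d by (simp add: power2_eq_square)
  also have "\<dots> = 16 * 4 ^ d" by (simp flip: power_mult_distrib)
  also have "\<dots> \<le> 32 * T" using power_le_exactly_computable[OF assms(1) _ assms(3), of d] k(1) d by simp
  finally show ?thesis .
qed

lemma Q_E_lower_bound:
  assumes "nonconst_monotone_graph_property n P" "2 \<le> n"
  shows "ereal (1 / 32 * (real n)\<^sup>2) \<le> ereal_of_enat (Q_E (edges n) P)"
proof (cases "\<exists>T. exactly_computable (edges n) P T")
  case True
  then have "Q_E (edges n) P \<in> enat ` {T. exactly_computable (edges n) P T}"
    unfolding Q_E_def by (intro wellorder_InfI[of "enat (SOME T. exactly_computable (edges n) P T)"])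
      (auto intro: someI)
  then obtain T where T: "exactly_computable (edges n) P T" "Q_E (edges n) P = enat T" by auto
  have "real (n\<^sup>2) \<le> real (32 * T)"
    using square_le_exactly_computable[OF assms T(1)] by (simp only: of_nat_le_iff)
  then show ?thesis by (simp add: T(2))
next
  case False
  then show ?thesis by (simp add: Q_E_def top_enat_def)
qed

section \<open>Exact algorithms from parity queries\<close>

text \<open>The parity query \<open>(i, j)\<close> asks for \<open>x\<^sub>i \<oplus> x\<^sub>j\<close>, with \<open>(i, i)\<close> encoding the plain query of
  \<open>x\<^sub>i\<close>.\<close>

definition answer :: "'j \<times> 'j \<Rightarrow> ('j \<Rightarrow> bool) \<Rightarrow> bool" where
  "answer p x = (if fst p = snd p then x (fst p) else x (fst p) \<noteq> x (snd p))"

inductive parity_tree :: "'j set \<Rightarrow> (('j \<Rightarrow> bool) \<Rightarrow> bool) \<Rightarrow> ('j \<Rightarrow> bool) set \<Rightarrow> nat \<Rightarrow> bool"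
  for J f where
  leaf: "(\<And>x. x \<in> S \<Longrightarrow> f x = b) \<Longrightarrow> parity_tree J f S T"
| node: "p \<in> J \<times> J \<Longrightarrow> parity_tree J f {x \<in> S. answer p x} T \<Longrightarrow>
    parity_tree J f {x \<in> S. \<not> answer p x} T \<Longrightarrow> parity_tree J f S (Suc T)"

primrec transcript :: "(bool list \<Rightarrow> 'j \<times> 'j) \<Rightarrow> ('j \<Rightarrow> bool) \<Rightarrow> nat \<Rightarrow> bool list" where
  "transcript q x 0 = []"
| "transcript q x (Suc t) = transcript q x t @ [answer (q (transcript q x t)) x]"

lemma length_transcript [simp]: "length (transcript q x t) = t"
  by (induction t) auto

text \<open>Transcripts grow at the end, whereas recursion on a tree has to split off the first
  answer.\<close>

lemma transcript_Suc_Cons: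
  "transcript q x (Suc t)
    = answer (q []) x # transcript (\<lambda>h. q (answer (q []) x # h)) x t"
proof (induction t)
  case (Suc t)
  have "transcript q x (Suc (Suc t))
      = transcript q x (Suc t) @ [answer (q (transcript q x (Suc t))) x]"
    by (rule transcript.simps)
  then show ?case unfolding Suc.IH by simp
qed simp

lemma parity_tree_imp_strategy:
  assumes "parity_tree J f S T" "J \<noteq> {}"
  shows "\<exists>q out. (\<forall>h. q h \<in> J \<times> J) \<and> (\<forall>x\<in>S. out (transcript q x T) = f x)"
  using assms(1)
proof (induction rule: parity_tree.induct)
  case (leaf S b T)
  \<comment> \<open>Early leaves are padded with dummy queries, so that every branch asks exactly
    \<open>T\<close>.\<close>
  obtain j where "j \<in> J" using assms(2) by auto
  then show ?case
    using leaf by (intro exI[of _ "\<lambda>_. (j, j)"] exI[of _ "\<lambda>_. b"]) auto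
next
  case (node p S T)
  obtain q out where 1: "\<And>h. q h \<in> J \<times> J" "\<And>x. x \<in> S \<Longrightarrow> answer p x \<Longrightarrow> out (transcript q x T) = f x"
    using node.IH(1) by auto
  obtain q' out' where 2: "\<And>h. q' h \<in> J \<times> J" "\<And>x. x \<in> S \<Longrightarrow> \<not> answer p x \<Longrightarrow> out' (transcript q' x T) = f x"
    using node.IH(2) by auto
  define Q where "Q h = (case h of [] \<Rightarrow> p | r # h \<Rightarrow> if r then q h else q' h)" for h
  define Out where "Out h = (if hd h then out (tl h) else out' (tl h))" for h
  have "Q h \<in> J \<times> J" for h
    using 1(1) 2(1) node.hyps(1) unfolding Q_def by (cases h) auto
  moreover have "Out (transcript Q x (Suc T)) = f x" if "x \<in> S" for x
  proof -
    have "Q [] = p" "(\<lambda>h. Q (r # h)) = (if r then q else q')" for r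
      by (auto simp: Q_def)
    then show ?thesis
      using 1(2) 2(2) that unfolding transcript_Suc_Cons by (auto simp: Out_def)
  qed
  ultimately show ?case by blast
qed

definition sgn_of :: "bool \<Rightarrow> complex" where
  "sgn_of b = (if b then - 1 else 1)"

lemma sgn_of_simps [simp]: "sgn_of True = - 1" "sgn_of False = 1" "cmod (sgn_of b) = 1"
  "cnj (sgn_of b) = sgn_of b" "sgn_of b * sgn_of b = 1" "sgn_of (b \<noteq> c) = sgn_of b * sgn_of c"
  by (auto simp: sgn_of_def)

text \<open>The state reached by the parity query \<open>(i, j)\<close> with answer \<open>r\<close>: for \<open>i \<noteq> j\<close> it is
  \<open>(|i\<rangle> + (-1)\<^sup>r |j\<rangle>) (|0\<rangle> - |1\<rangle>) / 2\<close>, and for \<open>i = j\<close> it is \<open>|i\<rangle> |r\<rangle>\<close>. With \<open>r = 0\<close> it is also the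
  state prepared before the query.\<close>

definition amplitude :: "'j \<times> 'j \<Rightarrow> bool \<Rightarrow> 'j \<Rightarrow> bool \<Rightarrow> complex" where
  "amplitude p r k b =
    (if fst p = snd p then (if k = fst p \<and> b = r then 1 else 0)
     else if k = fst p then sgn_of b / 2
     else if k = snd p then sgn_of r * sgn_of b / 2
     else 0)"

definition parity_state :: "'j \<times> 'j \<Rightarrow> bool \<Rightarrow> nat \<Rightarrow> 'j state" where
  "parity_state p r c = (\<lambda>(k, b, z). if z = c then amplitude p r k b else 0)"

text \<open>Phase kickback: on the target |0> - |1> the gate multiplies |k> by the sign of the k-th
  bit. Taking out the sign of the first bit as a global phase leaves the parity as the relative
  sign. A plain query needs no phase.\<close>

lemma query_parity_state:
  "\<exists>\<sigma>. cmod \<sigma> = 1 \<and> query x (parity_state p False c) = (\<lambda>a. \<sigma> * parity_state p (answer p x) c a)"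
proof (cases "fst p = snd p")
  case True
  then show ?thesis
    by (intro exI[of _ 1]) (auto simp: query_def parity_state_def amplitude_def answer_def)
next
  case False
  then show ?thesis
    by (intro exI[of _ "sgn_of (x (fst p))"])
      (auto simp: query_def parity_state_def amplitude_def answer_def sgn_of_def)
qed

text \<open>The two answers lead to orthogonal states, so the algorithm can branch on the answer
  without error.\<close>

lemma inner_on_parity_state:
  assumes "finite J" "p \<in> J \<times> J" "c < m"
  shows "inner_on (basis J m) (parity_state p r c) (parity_state p r' c) = (if r = r' then 1 else 0)"
proof -
  obtain i j where p: "p = (i, j)" "i \<in> J" "j \<in> J" using assms(2) by auto
  have "inner_on (basis J m) (parity_state p r c) (parity_state p r' c)
      = (\<Sum>k\<in>J. \<Sum>b\<in>UNIV. \<Sum>z<m. if z = c then cnj (amplitude p r k b) * amplitude p r' k b else 0)"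
    unfolding inner_on_def basis_def sum.cartesian_product
    by (intro sum.cong refl) (auto simp: parity_state_def)
  also have "\<dots> = (\<Sum>k\<in>J. \<Sum>b\<in>UNIV. cnj (amplitude p r k b) * amplitude p r' k b)"
    using assms(3) by simp
  also have "\<dots> = (\<Sum>k\<in>{i, j}. \<Sum>b\<in>UNIV. cnj (amplitude p r k b) * amplitude p r' k b)"
  proof (rule sum.mono_neutral_right)
    have "amplitude p r k b = 0" if "k \<notin> {i, j}" for k b
      using that by (simp add: amplitude_def p)
    then show "\<forall>k\<in>J - {i, j}. (\<Sum>b\<in>UNIV. cnj (amplitude p r k b) * amplitude p r' k b) = 0"
      by simp
  qed (use p assms(1) in auto)
  also have "\<dots> = (if r = r' then 1 else 0)"
    by (cases "i = j"; cases r; cases r') (simp_all add: p amplitude_def UNIV_bool)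
  finally show ?thesis .
qed

lemma inner_on_parity_state_neq:
  "c \<noteq> c' \<Longrightarrow> inner_on B (parity_state p r c) (parity_state p' r' c') = 0"
  unfolding inner_on_def by (intro sum.neutral) (auto simp: parity_state_def)

lemma exactly_computable_strategy:
  fixes q :: "bool list \<Rightarrow> 'j \<times> 'j"
  assumes "finite J" and q: "\<And>h. q h \<in> J \<times> J"
    and out: "\<And>x. x \<in> inputs J \<Longrightarrow> out (transcript q x T) = f x"
  shows "exactly_computable J f T"
proof -
  define m where "m = Suc (Max (to_nat ` {h :: bool list. length h \<le> T}))"
  define B where "B = basis J m"
  have fin: "finite {h :: bool list. length h \<le> T}"
    using finite_lists_length_le[of "UNIV :: bool set" T] by simp
  have m: "to_nat h < m" if "length h \<le> T" for h :: "bool list"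
    using fin that unfolding m_def by (intro le_imp_less_Suc Max_ge) auto
  have B: "finite B" using assms(1) by (simp add: B_def)
  let ?v = "\<lambda>r h. parity_state (q h) r (to_nat h)"
  have orth: "inner_on B (?v r h) (?v r' h') = (if r = r' \<and> h = h' then 1 else 0)"
    if "length h \<le> T" for r r' h h'
    using inner_on_parity_state[OF assms(1) q m[OF that], of h r r']
    by (cases "h = h'") (simp_all add: B_def inner_on_parity_state_neq)
  define s where "s = (fst (q []), False, 0 :: nat)"
  have s: "s \<in> B"
    using q[of "[]"] by (auto simp: s_def B_def basis_def m_def)
  have "inner_on B (\<lambda>a. if a = s then 1 else 0) (\<lambda>a. if a = s then 1 else 0) = (\<Sum>a\<in>B. if a = s then 1 else 0)"
    unfolding inner_on_def by (intro sum.cong) auto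
  then have "inner_on B (\<lambda>a. if a = s then 1 else 0) (\<lambda>a. if a = s then 1 else 0) = 1"
    using B s by simp
  then have "\<exists>U. unitary_on B U \<and>
      (\<forall>k\<in>{()}. \<forall>a\<in>B. apply_oper B U (\<lambda>a. if a = s then 1 else 0) a = ?v False [] a)"
    using ex_unitary_orthonormal_families[of B "{()}" "\<lambda>_ a. if a = s then 1 else 0" "\<lambda>_. ?v False []"]
      B s orth[of "[]" False "[]" False]
    by (simp add: orthonormal_family_def)
  then obtain U0 where U0: "unitary_on B U0"
    "\<And>a. a \<in> B \<Longrightarrow> apply_oper B U0 (\<lambda>a. if a = s then 1 else 0) a = ?v False [] a"
    by auto
  have "\<exists>U. unitary_on B U \<and> (\<forall>h r. length h = t \<longrightarrow>
      (\<forall>a\<in>B. apply_oper B U (?v r h) a = ?v False (h @ [r]) a))" if "t < T" for t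
  proof -
    have "\<exists>U. unitary_on B U \<and>
        (\<forall>k\<in>{h. length h = t} \<times> UNIV. \<forall>a\<in>B. apply_oper B U (case k of (h, r) \<Rightarrow> ?v r h) a
           = (case k of (h, r) \<Rightarrow> ?v False (h @ [r])) a)"
    proof (rule ex_unitary_orthonormal_families[OF B])
      show "finite ({h :: bool list. length h = t} \<times> (UNIV :: bool set))"
        using finite_lists_length_eq[of "UNIV :: bool set" t] by simp
    qed (use that in \<open>auto simp: orthonormal_family_def orth\<close>)
    then show ?thesis by auto
  qed
  then obtain U' where U': "\<And>t. t < T \<Longrightarrow> unitary_on B (U' t)"
    "\<And>t h r a. t < T \<Longrightarrow> length h = t \<Longrightarrow> a \<in> B \<Longrightarrow>
        apply_oper B (U' t) (?v r h) a = ?v False (h @ [r]) a"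
    by metis
  define U where "U t = (case t of 0 \<Rightarrow> U0 | Suc t \<Rightarrow> U' t)" for t
  have U: "unitary_on B (U t)" if "t \<le> T" for t
    using that U0(1) U'(1) by (cases t) (auto simp: U_def)
  \<comment> \<open>The phase may depend on \<open>x\<close> but not on the basis element, so no
    measurement sees it. At \<open>t = T\<close> the state is prepared for a further query that is
    never made; only its record is read.\<close>
  have run: "\<exists>\<sigma>. cmod \<sigma> = 1 \<and> (\<forall>a\<in>B. run B U s x t a = \<sigma> * ?v False (transcript q x t) a)"
    if "t \<le> T" for x t
    using that
  proof (induction t)
    case 0
    show ?case using U0(2) by (intro exI[of _ 1]) (simp add: U_def)
  next
    case (Suc t)
    let ?h = "transcript q x t"
    let ?r = "answer (q ?h) x"
    obtain \<sigma> where \<sigma>: "cmod \<sigma> = 1" "\<And>a. a \<in> B \<Longrightarrow> run B U s x t a = \<sigma> * ?v False ?h a"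
      using Suc by auto
    obtain \<sigma>' where \<sigma>': "cmod \<sigma>' = 1" "query x (?v False ?h) = (\<lambda>a. \<sigma>' * ?v ?r ?h a)"
      using query_parity_state by blast
    have "query x (run B U s x t) a = (\<sigma> * \<sigma>') * ?v ?r ?h a" if "a \<in> B" for a
    proof -
      obtain k b z where a: "a = (k, b, z)" by (metis prod_cases3)
      then have "query x (run B U s x t) a = \<sigma> * query x (?v False ?h) a"
        using that \<sigma>(2)[of "(k, b \<noteq> x k, z)"] by (simp add: query_def B_def basis_def)
      then show ?thesis by (simp add: \<sigma>'(2))
    qed
    then have "run B U s x (Suc t) = (\<lambda>a. (\<sigma> * \<sigma>') * apply_oper B (U' t) (?v ?r ?h) a)"
      unfolding apply_oper_scale[symmetric] run.simps U_def nat.case by (rule apply_oper_cong)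
    then have "\<forall>a\<in>B. run B U s x (Suc t) a = (\<sigma> * \<sigma>') * ?v False (transcript q x (Suc t)) a"
      using U'(2)[of t ?h] Suc.prems by simp
    then show ?case
      using \<sigma>(1) \<sigma>'(1) by (intro exI[of _ "\<sigma> * \<sigma>'"]) (simp add: norm_mult)
  qed
  define A where "A = {(k :: 'j, b :: bool, z). out (from_nat z)}"
  have "output_prob B A (run B U s x T) (f x) = 1" if "x \<in> inputs J" for x
  proof -
    let ?\<psi> = "run B U s x T"
    obtain \<sigma> where \<sigma>: "\<And>a. a \<in> B \<Longrightarrow> ?\<psi> a = \<sigma> * ?v False (transcript q x T) a"
      using run[of T x] by auto
    have "output_prob B A ?\<psi> (f x) = (\<Sum>a\<in>B. (cmod (?\<psi> a))\<^sup>2)"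
      unfolding output_prob_def
    proof (rule sum.mono_neutral_left)
      show "\<forall>a\<in>B - {a \<in> B. (a \<in> A) = f x}. (cmod (?\<psi> a))\<^sup>2 = 0"
      proof
        fix a assume a: "a \<in> B - {a \<in> B. (a \<in> A) = f x}"
        then have "?v False (transcript q x T) a = 0"
          using out[OF that] by (auto simp: parity_state_def A_def split: prod.splits)
        then show "(cmod (?\<psi> a))\<^sup>2 = 0" using \<sigma>[of a] a by simp
      qed
    qed (auto simp: B)
    also have "\<dots> = 1"
      using run_norm[OF assms(1), of s m T U x] s U by (simp add: B_def)
    finally show ?thesis .
  qed
  then show ?thesis
    unfolding exactly_computable_def using s U unfolding B_def
    by (intro exI[of _ m] exI[of _ s] exI[of _ U] exI[of _ A]) auto
qed

lemma exactly_computable_parity_tree: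
  assumes "finite J" "J \<noteq> {}" "parity_tree J f (inputs J) T"
  shows "exactly_computable J f T"
proof -
  obtain q out where "\<And>h. q h \<in> J \<times> J" "\<And>x. x \<in> inputs J \<Longrightarrow> out (transcript q x T) = f x"
    using parity_tree_imp_strategy[OF assms(3,2)] by blast
  then show ?thesis by (rule exactly_computable_strategy[OF assms(1)])
qed

section \<open>Saving a query for threshold functions\<close>

lemma parity_tree_read:
  assumes "finite D" "D \<subseteq> J" "card D \<le> T"
    and "\<And>x y. x \<in> S \<Longrightarrow> y \<in> S \<Longrightarrow> (\<And>d. d \<in> D \<Longrightarrow> x d = y d) \<Longrightarrow> f x = f y"
  shows "parity_tree J f S T"
  using assms
proof (induction D arbitrary: S T rule: finite_induct)
  case empty
  then have "f x = f (SOME x. x \<in> S)" if "x \<in> S" for x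
    using that someI[of "\<lambda>x. x \<in> S"] by blast
  then show ?case by (rule parity_tree.leaf)
next
  case (insert d D)
  then obtain T' where T': "T = Suc T'" "card D \<le> T'" by (cases T) auto
  have "parity_tree J f {x \<in> S. x d = b} T'" for b
    using insert.prems T'(2) by (intro insert.IH) (auto simp: all_conj_distrib)
  from this[of True] this[of False] show ?case
    unfolding T'(1) using insert.prems(1)
    by (intro parity_tree.node[of "(d, d)"]) (auto simp: answer_def)
qed

text \<open>As soon as two paired bits differ, the function no longer depends on which of them is set, so one
  query has been saved; otherwise all pairs are found to agree.\<close>

lemma parity_tree_pairs:
  assumes "finite P" "inj_on g P" "P \<inter> g ` P = {}" "P \<subseteq> D" "g ` P \<subseteq> D" "finite D" "D \<subseteq> J"
    and "\<And>i x y. i \<in> P \<Longrightarrow> x \<in> S \<Longrightarrow> y \<in> S \<Longrightarrow> x i \<noteq> x (g i) \<Longrightarrow> y i \<noteq> y (g i) \<Longrightarrow>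
      (\<And>d. d \<in> D - {i, g i} \<Longrightarrow> x d = y d) \<Longrightarrow> f x = f y"
    and "parity_tree J f {x \<in> S. \<forall>i\<in>P. x i = x (g i)} T" "card D \<le> T + card P + 1"
  shows "parity_tree J f S (T + card P)"
  using assms
proof (induction P arbitrary: S D rule: finite_induct)
  case empty
  then show ?case by simp
next
  case (insert i P)
  have i: "i \<noteq> g i" "i \<in> D" "g i \<in> D" using insert.prems by auto
  have "parity_tree J f {x \<in> S. x i \<noteq> x (g i)} (T + card P)"
  proof (rule parity_tree_read)
    have "card {i, g i} \<le> card D" using i insert.prems(5) by (intro card_mono) auto
    then show "card (D - {i, g i}) \<le> T + card P"
      using insert.prems(9) insert.hyps i by (simp add: card_Diff_subset)
    fix x y
    assume "x \<in> {x \<in> S. x i \<noteq> x (g i)}" "y \<in> {x \<in> S. x i \<noteq> x (g i)}" "\<And>d. d \<in> D - {i, g i} \<Longrightarrow> x d = y d"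
    then show "f x = f y" using insert.prems(7)[of i x y] by blast
  qed (use insert.prems(5,6) in auto)
  moreover have "parity_tree J f {x \<in> S. x i = x (g i)} (T + card P)"
  \<comment> \<open>After agreement, bit \<open>g i\<close> is a copy of bit \<open>i\<close> and
    need not be read, so the query just spent is paid for by removing \<open>g i\<close> from
    \<open>D\<close>.\<close>
  proof (rule insert.IH)
    show "P \<subseteq> D - {g i}" "g ` P \<subseteq> D - {g i}"
      using insert.prems(1-4) insert.hyps by (auto simp: inj_on_def)
    fix k x y
    assume k: "k \<in> P" and xy: "x \<in> {x \<in> S. x i = x (g i)}" "y \<in> {x \<in> S. x i = x (g i)}"
      "x k \<noteq> x (g k)" "y k \<noteq> y (g k)" "\<And>d. d \<in> D - {g i} - {k, g k} \<Longrightarrow> x d = y d"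
    have "i \<in> D - {g i} - {k, g k}"
      using k i insert.prems(2) insert.hyps(2) by auto
    then have "x (g i) = y (g i)" using xy(1,2,5) by auto
    then show "f x = f y"
      using insert.prems(7)[of k x y] xy k by blast
  next
    have "{x \<in> S. x i = x (g i) \<and> (\<forall>i\<in>P. x i = x (g i))} = {x \<in> S. \<forall>i\<in>insert i P. x i = x (g i)}"
      by auto
    then show "parity_tree J f {x \<in> {x \<in> S. x i = x (g i)}. \<forall>i\<in>P. x i = x (g i)} T"
      using insert.prems(8) by simp
    show "card (D - {g i}) \<le> T + card P + 1"
      using insert.prems(5,9) insert.hyps i by simp
  qed (use insert.prems in auto)
  ultimately have "parity_tree J f S (Suc (T + card P))"
    using i insert.prems(6) by (intro parity_tree.node[of "(i, g i)"]) (auto simp: answer_def)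
  then show ?case using insert.hyps by simp
qed

section \<open>Counting set bits, and thresholds under pairing\<close>

definition num_true :: "'j set \<Rightarrow> ('j \<Rightarrow> bool) \<Rightarrow> nat" where
  "num_true R x = card {r \<in> R. x r}"

lemma num_true_Un:
  "finite R \<Longrightarrow> finite R' \<Longrightarrow> R \<inter> R' = {} \<Longrightarrow> num_true (R \<union> R') x = num_true R x + num_true R' x"
proof -
  assume "finite R" "finite R'" "R \<inter> R' = {}"
  moreover have "{r \<in> R \<union> R'. x r} = {r \<in> R. x r} \<union> {r \<in> R'. x r}" by auto
  ultimately show ?thesis
    unfolding num_true_def by (simp add: card_Un_disjoint disjoint_iff)
qed

lemma num_true_cong: "(\<And>r. r \<in> R \<Longrightarrow> x r = y r) \<Longrightarrow> num_true R x = num_true R y"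
  unfolding num_true_def by (rule arg_cong[where f = card]) auto

lemma num_true_le: "finite R \<Longrightarrow> num_true R x \<le> card R"
  unfolding num_true_def by (rule card_mono) auto

lemma num_true_image: "inj_on g P \<Longrightarrow> (\<And>i. i \<in> P \<Longrightarrow> x i = x (g i)) \<Longrightarrow> num_true (g ` P) x = num_true P x"
proof -
  assume g: "inj_on g P" "\<And>i. i \<in> P \<Longrightarrow> x i = x (g i)"
  then have "{r \<in> g ` P. x r} = g ` {i \<in> P. x i}" by auto
  moreover have "inj_on g {i \<in> P. x i}" using g(1) by (rule inj_on_subset) auto
  ultimately show ?thesis by (simp add: num_true_def card_image)
qed

lemma num_true_doubleton: "i \<noteq> j \<Longrightarrow> x i \<noteq> x j \<Longrightarrow> num_true {i, j} x = 1"
proof -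
  assume "i \<noteq> j" "x i \<noteq> x j"
  then have "{r \<in> {i, j}. x r} = (if x i then {i} else {j})" by auto
  then show ?thesis by (simp add: num_true_def)
qed

lemma ex_pairing:
  fixes R :: "'j set"
  assumes "finite R"
  shows "\<exists>P g. P \<subseteq> R \<and> g ` P \<subseteq> R \<and> inj_on g P \<and> P \<inter> g ` P = {} \<and> card P = card R div 2"
proof -
  obtain P where P: "P \<subseteq> R" "card P = card R div 2" "finite P"
    using obtain_subset_with_card_n[of "card R div 2" R] by auto
  then have "card R div 2 \<le> card (R - P)" by (simp add: card_Diff_subset)
  then obtain P' where P': "P' \<subseteq> R - P" "card P' = card R div 2" "finite P'"
    using obtain_subset_with_card_n by metis
  obtain g where "bij_betw g P P'"
    using finite_same_card_bij[OF P(3) P'(3)] P P' by auto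
  then show ?thesis
    using P P' by (intro exI[of _ P] exI[of _ g]) (auto simp: bij_betw_def)
qed

lemma num_true_pairs:
  assumes "finite R" "P \<subseteq> R" "g ` P \<subseteq> R" "inj_on g P" "P \<inter> g ` P = {}"
    and "\<And>i. i \<in> P \<Longrightarrow> x i = x (g i)"
  shows "num_true R x = 2 * num_true P x + num_true (R - (P \<union> g ` P)) x"
proof -
  have fin: "finite P" using assms(1,2) finite_subset by blast
  have "R = P \<union> g ` P \<union> (R - (P \<union> g ` P))" using assms(2,3) by auto
  then have "num_true R x = num_true (P \<union> g ` P) x + num_true (R - (P \<union> g ` P)) x"
    using num_true_Un[of "P \<union> g ` P" "R - (P \<union> g ` P)" x] fin assms(1) by auto
  also have "num_true (P \<union> g ` P) x = num_true P x + num_true P x"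
    using num_true_Un[of P "g ` P" x] fin assms(4-6) by (simp add: num_true_image)
  finally show ?thesis by simp
qed

text \<open>A differing pair contributes exactly 1 to the count, whichever of its bits is set, so
  neither bit has to be read.\<close>

lemma parity_tree_threshold_pairs:
  assumes "finite R" "R \<subseteq> J" "P \<subseteq> R" "g ` P \<subseteq> R" "inj_on g P" "P \<inter> g ` P = {}"
    and f: "\<And>x. x \<in> S \<Longrightarrow> f x \<longleftrightarrow> t \<le> num_true R x"
    and T: "parity_tree J f {x \<in> S. \<forall>i\<in>P. x i = x (g i)} T" "card R \<le> T + card P + 1"
  shows "parity_tree J f S (T + card P)"
proof (rule parity_tree_pairs)
  show "finite P" using assms(1,3) finite_subset by blast
  fix i x y
  assume i: "i \<in> P" and xy: "x \<in> S" "y \<in> S" "x i \<noteq> x (g i)" "y i \<noteq> y (g i)"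
    "\<And>d. d \<in> R - {i, g i} \<Longrightarrow> x d = y d"
  have "i \<noteq> g i" using i assms(6) by auto
  have "num_true R z = 1 + num_true (R - {i, g i}) z" if "z i \<noteq> z (g i)" for z
  proof -
    have "R = {i, g i} \<union> (R - {i, g i})" using i assms(3,4) by auto
    then show ?thesis
      using num_true_Un[of "{i, g i}" "R - {i, g i}" z] assms(1)
        num_true_doubleton[OF \<open>i \<noteq> g i\<close> that] by auto
  qed
  moreover have "num_true (R - {i, g i}) x = num_true (R - {i, g i}) y"
    by (rule num_true_cong) (rule xy(5))
  ultimately have "num_true R x = num_true R y" using xy(3,4) by simp
  then show "f x = f y" using f xy(1,2) by simp
qed (fact assms)+

text \<open>Halving the bits halves the threshold. Once the number of bits is odd and the threshold is 2, the
  unpaired bit is irrelevant when all pairs agree.\<close>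

lemma parity_tree_threshold:
  assumes "finite R" "R \<subseteq> J" "card R = 2 ^ a * b" "odd b"
    and "\<And>x. x \<in> S \<Longrightarrow> f x \<longleftrightarrow> 2 ^ Suc a \<le> num_true R x"
  shows "parity_tree J f S (card R - 1)"
  using assms(1-3,5)
proof (induction a arbitrary: R S)
  case 0
  obtain P g where P: "P \<subseteq> R" "g ` P \<subseteq> R" "inj_on g P" "P \<inter> g ` P = {}" "card P = card R div 2"
    using ex_pairing[OF 0(1)] by blast
  have fin: "finite P" using P(1) 0(1) finite_subset by blast
  let ?C = "R - (P \<union> g ` P)"
  have card_R: "card R = 2 * card P + 1" using P(5) 0(3) assms(4) by simp
  have "card (P \<union> g ` P) = 2 * card P"
    using P(3,4) fin by (simp add: card_Un_disjoint card_image)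
  then have "card ?C = 1"
    using P(1,2) fin card_R by (simp add: card_Diff_subset)
  \<comment> \<open>The unpaired bit adds at most 1 to an even count, which never decides whether 2
    is reached.\<close>
  have fP: "f x \<longleftrightarrow> 1 \<le> num_true P x" if "x \<in> S" "\<And>i. i \<in> P \<Longrightarrow> x i = x (g i)" for x
  proof -
    have "num_true ?C x \<le> 1"
      using num_true_le[of ?C x] 0(1) \<open>card ?C = 1\<close> by simp
    moreover have "num_true R x = 2 * num_true P x + num_true ?C x"
      by (rule num_true_pairs[OF 0(1) P(1-4)]) (rule that(2))
    moreover have "f x \<longleftrightarrow> 2 \<le> num_true R x" using 0(4)[OF that(1)] by simp
    ultimately show ?thesis by linarith
  qed
  have "parity_tree J f {x \<in> S. \<forall>i\<in>P. x i = x (g i)} (card P)"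
  proof (rule parity_tree_read[OF fin])
    fix x y
    assume *: "x \<in> {x \<in> S. \<forall>i\<in>P. x i = x (g i)}" "y \<in> {x \<in> S. \<forall>i\<in>P. x i = x (g i)}"
      "\<And>d. d \<in> P \<Longrightarrow> x d = y d"
    have "num_true P x = num_true P y" by (rule num_true_cong) (rule *(3))
    moreover have "f z \<longleftrightarrow> 1 \<le> num_true P z" if "z \<in> {x \<in> S. \<forall>i\<in>P. x i = x (g i)}" for z
      using that by (intro fP) auto
    ultimately show "f x = f y" using *(1,2) by (simp only:)
  qed (use P(1) 0(2) in auto)
  note tree = this
  have "parity_tree J f S (card P + card P)"
    by (rule parity_tree_threshold_pairs[OF 0(1,2) P(1-4) _ tree]) (use 0(4) card_R in auto)
  then show ?case using card_R by (simp add: mult_2)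
next
  case (Suc a)
  obtain P g where P: "P \<subseteq> R" "g ` P \<subseteq> R" "inj_on g P" "P \<inter> g ` P = {}" "card P = card R div 2"
    using ex_pairing[OF Suc(2)] by blast
  have fin: "finite P" using P(1) Suc(2) finite_subset by blast
  have card_P: "card P = 2 ^ a * b" "card R = 2 * card P" using P(5) Suc(4) by simp_all
  have "card P > 0" using assms(4) unfolding card_P(1) by (cases b) auto
  have "card (P \<union> g ` P) = 2 * card P"
    using P(3,4) fin by (simp add: card_Un_disjoint card_image)
  then have "P \<union> g ` P = R"
    using card_P(2) P(1,2) by (intro card_subset_eq[OF Suc(2)]) auto
  then have R: "R - (P \<union> g ` P) = {}" by simp
  have "parity_tree J f {x \<in> S. \<forall>i\<in>P. x i = x (g i)} (card P - 1)"
  proof (rule Suc.IH[OF fin _ card_P(1)])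
    fix x assume x: "x \<in> {x \<in> S. \<forall>i\<in>P. x i = x (g i)}"
    have "num_true R x = 2 * num_true P x + num_true (R - (P \<union> g ` P)) x"
      by (rule num_true_pairs[OF Suc(2) P(1-4)]) (use x in blast)
    moreover have "f x \<longleftrightarrow> 2 * 2 ^ Suc a \<le> num_true R x"
      using Suc.prems(4)[of x] x by auto
    ultimately show "f x \<longleftrightarrow> 2 ^ Suc a \<le> num_true P x"
      unfolding R by (simp add: num_true_def)
  qed (use P(1) Suc(3) in auto)
  note tree = this
  have "parity_tree J f S (card P - 1 + card P)"
    by (rule parity_tree_threshold_pairs[OF Suc(2,3) P(1-4) _ tree])
      (use Suc.prems(4) card_P(2) \<open>card P > 0\<close> in auto)
  then show ?case using card_P(2) \<open>card P > 0\<close> by (simp add: mult_2)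
qed

section \<open>Thresholds on the number of edges as graph properties\<close>

lemma nonconst_monotone_threshold:
  assumes "1 \<le> t" "t \<le> card (edges n)"
  shows "nonconst_monotone_graph_property n (\<lambda>x. t \<le> num_true (edges n) x)"
  unfolding nonconst_monotone_graph_property_def
proof (intro conjI)
  show "graph_property n (\<lambda>x. t \<le> num_true (edges n) x)"
    unfolding graph_property_def
  proof (intro allI impI ballI)
    fix \<pi> and x :: "nat \<times> nat \<Rightarrow> bool" assume \<pi>: "\<pi> permutes {..<n}"
    have inj: "inj (map_prod \<pi> \<pi>)" using permutes_inj[OF \<pi>] by (simp add: prod.inj_map)
    have e: "(\<pi> i, \<pi> j) \<in> edges n \<longleftrightarrow> (i, j) \<in> edges n" for i j
      using permutes_in_image[OF \<pi>] permutes_inj[OF \<pi>] by (auto simp: edges_def inj_def)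
    have "map_prod \<pi> \<pi> ` {e \<in> edges n. relabel n \<pi> x e} = {e \<in> edges n. x e}"
    proof (intro equalityI subsetI)
      fix e assume "e \<in> {e \<in> edges n. x e}"
      moreover obtain i j where "e = (\<pi> i, \<pi> j)"
        using permutes_surj[OF \<pi>] by (metis surj_def prod.exhaust)
      ultimately show "e \<in> map_prod \<pi> \<pi> ` {e \<in> edges n. relabel n \<pi> x e}"
        by (intro image_eqI[of _ _ "(i, j)"]) (auto simp: e relabel_def)
    qed (auto simp: e relabel_def)
    then have "num_true (edges n) (relabel n \<pi> x) = num_true (edges n) x"
      unfolding num_true_def
      using card_image[OF inj_on_subset[OF inj subset_UNIV], of "{e \<in> edges n. relabel n \<pi> x e}"] by simp
    then show "(t \<le> num_true (edges n) (relabel n \<pi> x)) = (t \<le> num_true (edges n) x)" by simp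
  qed
  show "mono_on (inputs (edges n)) (\<lambda>x. t \<le> num_true (edges n) x)"
  proof (rule mono_onI)
    fix x y :: "nat \<times> nat \<Rightarrow> bool" assume "x \<le> y"
    then have "num_true (edges n) x \<le> num_true (edges n) y"
      unfolding num_true_def by (intro card_mono) (auto simp: le_fun_def)
    then show "(t \<le> num_true (edges n) x) \<le> (t \<le> num_true (edges n) y)" by auto
  qed
  have "restrict (\<lambda>_. b) (edges n) \<in> inputs (edges n)" for b by (simp add: inputs_def)
  moreover have "num_true (edges n) (restrict (\<lambda>_. False) (edges n)) = 0"
    "num_true (edges n) (restrict (\<lambda>_. True) (edges n)) = card (edges n)"
    by (simp_all add: num_true_def cong: conj_cong)
  ultimately have "v \<in> (\<lambda>x. t \<le> num_true (edges n) x) ` inputs (edges n)" for v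
    using assms by (intro image_eqI[of _ _ "restrict (\<lambda>_. v) (edges n)"]) (cases v; simp)+
  then show "(\<lambda>x. t \<le> num_true (edges n) x) ` inputs (edges n) = {False, True}" by blast
qed

text \<open>For \<open>n > 2\<close>, one of \<open>n\<close> and \<open>n - 1\<close> is odd and greater than 1, so \<open>n(n - 1)\<close> is not a power
  of 2.\<close>

lemma ex_power_times_odd:
  fixes n :: nat
  assumes "n > 2"
  shows "\<exists>a b. n * (n - 1) = 2 ^ a * b \<and> odd b \<and> b > 1"
proof -
  let ?N = "n * (n - 1)"
  define c where "c = (if odd n then n else n - 1)"
  have c: "odd c" "c > 1" "c dvd ?N" using assms by (auto simp: c_def)
  have "?N > 0" using assms by simp
  then obtain a b where ab: "?N = 2 ^ a * b" "odd b"
    using multiplicity_decompose'[of ?N 2] by (metis odd_one not_gr_zero)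
  have "coprime c (2 ^ a)" using c(1) by simp
  then have "c dvd b" using c(3) unfolding ab(1) by (simp add: coprime_dvd_mult_right_iff)
  moreover have "b > 0" using ab \<open>?N > 0\<close> by (cases b) auto
  ultimately have "b > 1" using c(2) dvd_imp_le[of c b] by simp
  then show ?thesis using ab by blast
qed

lemma ex_property_saving_a_query:
  assumes "n \<ge> 2"
  shows "\<exists>P. nonconst_monotone_graph_property n P \<and> (n > 2 \<longrightarrow> Q_E (edges n) P < enat (n * (n - 1)))"
proof (cases "n > 2")
  case True
  obtain a b where ab: "n * (n - 1) = 2 ^ a * b" "odd b" "b > 1"
    using ex_power_times_odd[OF True] by blast
  let ?P = "\<lambda>x. 2 ^ Suc a \<le> num_true (edges n) x"
  have card: "card (edges n) = 2 ^ a * b" using ab(1) by (simp add: card_edges)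
  have "edges n \<noteq> {}" using card ab(3) by (metis card.empty mult_eq_0_iff not_one_less_zero power_not_zero zero_neq_numeral)
  moreover have "parity_tree (edges n) ?P (inputs (edges n)) (card (edges n) - 1)"
    by (rule parity_tree_threshold[OF _ _ card ab(2)]) auto
  ultimately have "exactly_computable (edges n) ?P (card (edges n) - 1)"
    by (intro exactly_computable_parity_tree) auto
  then have "Q_E (edges n) ?P \<le> enat (n * (n - 1) - 1)"
    unfolding Q_E_def card_edges by (intro INF_lower) auto
  also have "\<dots> < enat (n * (n - 1))" using True by simp
  finally have "Q_E (edges n) ?P < enat (n * (n - 1))" .
  \<comment> \<open>Here \<open>b > 1\<close> enters: if the number of edges were
    \<open>2 ^ a\<close>, the threshold would exceed it and the property would be constant.\<close>
  moreover have "2 ^ Suc a \<le> card (edges n)" unfolding card using ab(3) by simp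
  then have "nonconst_monotone_graph_property n ?P" by (intro nonconst_monotone_threshold) auto
  ultimately show ?thesis by blast
next
  case False
  then have "n = 2" using assms by simp
  then show ?thesis
    using nonconst_monotone_threshold[of 1 n] by (auto simp: card_edges)
qed

theorem theorem13:
  "(\<exists>c::real>0. \<exists>n0::nat. \<forall>n\<ge>n0. \<forall>P. nonconst_monotone_graph_property n P \<longrightarrow>
      ereal (c * (real n)\<^sup>2) \<le> ereal_of_enat (Q_E (edges n) P)) \<and>
   (\<exists>P :: nat \<Rightarrow> (nat \<times> nat \<Rightarrow> bool) \<Rightarrow> bool.
      (\<forall>n\<ge>2. nonconst_monotone_graph_property n (P n)) \<and>
      (\<forall>n>2. Q_E (edges n) (P n) < enat (n * (n - 1))))"
proof (intro conjI)
  show "\<exists>c::real>0. \<exists>n0::nat. \<forall>n\<ge>n0. \<forall>P. nonconst_monotone_graph_property n P \<longrightarrow>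
      ereal (c * (real n)\<^sup>2) \<le> ereal_of_enat (Q_E (edges n) P)"
    by (intro exI[of _ "1 / 32"] conjI exI[of _ 2] allI impI Q_E_lower_bound) auto
  have "\<forall>n. \<exists>P. n \<ge> 2 \<longrightarrow> nonconst_monotone_graph_property n P \<and>
      (n > 2 \<longrightarrow> Q_E (edges n) P < enat (n * (n - 1)))"
    using ex_property_saving_a_query by blast
  then obtain P where "\<forall>n. n \<ge> 2 \<longrightarrow> nonconst_monotone_graph_property n (P n) \<and>
      (n > 2 \<longrightarrow> Q_E (edges n) (P n) < enat (n * (n - 1)))"
    by (rule choice[THEN exE])
  then show "\<exists>P :: nat \<Rightarrow> (nat \<times> nat \<Rightarrow> bool) \<Rightarrow> bool.
      (\<forall>n\<ge>2. nonconst_monotone_graph_property n (P n)) \<and>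
      (\<forall>n>2. Q_E (edges n) (P n) < enat (n * (n - 1)))"
    by (intro exI[of _ P]) auto
qed

end
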